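(* Let $f:X\to\mathbb{R}$ be Lipschitz with $f>0$. (1) Every weak* accumulation point of $\pi_{c,N}$ as $c\to\infty$, $N\to\infty$ is in $M_{max}(f)$, and likewise every weak* accumulation point of $\eta_{c,N}$ as $c\to\infty$, $N\to\infty$ is in $M_{max}(f)$. (2) If $g:X\to\mathbb{R}$ is continuous and $c_j\to\infty$, $N_j\to\infty$ are such that $\lim_{j\to\infty}\int g\,d\pi_{c_j,N_j}$ exists, then this limit equals $\int g\,d\mu$ for some weak* accumulation point $\mu$ of $\pi_{c,N}$ (as $c,N\to\infty$). The same holds with $\eta_{c,N}$ in place of $\pi_{c,N}$. (3) In particular, if $M_{max}(f)=\{\mu_\infty\}$ is a singleton, then for every continuous $g:X\to\mathbb{R}$, $$\lim_{c,N\to\infty}\int g\,d\pi_{c,N}=\lim_{c,N\to\infty}\int g\,d\eta_{c,N}=\int g\,d\mu_\infty.$$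
   Context: $X=\{1,\dots,d\}^{\mathbb{N}}$ is the full Bernoulli space with shift $\sigma$ and metric $d(x,y)=\theta^{N}$, where $N$ is the first index with $x_N\ne y_N$ (and $d(x,x)=0$), $0<\theta<1$ fixed. Lipschitz is with respect to this metric. For $g:X\to\mathbb{R}$, $g^n(x)=g(x)+g(\sigma x)+\dots+g(\sigma^{n-1}x)$. $\mathrm{Fix}_n=\{x:\sigma^n(x)=x\}$. $P(\cdot)$ is topological pressure for $\sigma$. $\mathcal{M}$ is the set of $\sigma$-invariant Borel probabilities, $\beta(f)=\sup_{\nu\in\mathcal{M}}\int f\,d\nu$, $M_{max}(f)=\{\nu\in\mathcal{M}:\int f\,d\nu=\beta(f)\}$. For $c>0$, $N\in\mathbb{N}$, $\pi_{c,N},\eta_{c,N}\in\mathcal{M}$ are given, for continuous $g$, by $$\int g\,d\pi_{c,N}=\frac{\sum_{n=1}^{N}\sum_{x\in \mathrm{Fix}_{n}}e^{cf^{n}(x)-nP(cf)}\frac{g^{n}(x)}{n}}{\sum_{n=1}^{N}\sum_{x\in \mathrm{Fix}_{n}}e^{cf^{n}(x)-nP(cf)}},\qquad \int g\,d\eta_{c,N}=\frac{\sum_{n=1}^{N}\sum_{x\in \mathrm{Fix}_{n}}e^{cf^{n}(x)}\frac{g^{n}(x)}{n}}{\sum_{n=1}^{N}\sum_{x\in \mathrm{Fix}_{n}}e^{cf^{n}(x)}}.$$ An accumulation point as $c,N\to\infty$ is a weak* limit along some sequences $c_j\to\infty$, $N_j\to\infty$. *)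

theory Defs
  imports "HOL-Probability.Probability"
begin

text \<open>Sequences are indexed from 0, so distinct points have distance \<open>\<theta> ^ N\<close> with
  \<open>N \<ge> 0\<close>. Indexing from 1 would only rescale the metric by \<open>\<theta>\<close>.\<close>

definition shift_space :: "nat \<Rightarrow> (nat \<Rightarrow> nat) set" where
  "shift_space d = {x. \<forall>i. x i \<in> {1..d}}"

definition shift_dist :: "real \<Rightarrow> (nat \<Rightarrow> nat) \<Rightarrow> (nat \<Rightarrow> nat) \<Rightarrow> real" where
  "shift_dist \<theta> x y = (if x = y then 0 else \<theta> ^ (LEAST N. x N \<noteq> y N))"

definition full_shift :: "nat \<Rightarrow> real \<Rightarrow> (nat \<Rightarrow> nat) metric" where
  "full_shift d \<theta> = metric (shift_space d, shift_dist \<theta>)"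

definition shift_map :: "(nat \<Rightarrow> nat) \<Rightarrow> nat \<Rightarrow> nat" where
  "shift_map x = (\<lambda>i. x (Suc i))"

definition birkhoff_sum :: "('a \<Rightarrow> 'a) \<Rightarrow> ('a \<Rightarrow> real) \<Rightarrow> nat \<Rightarrow> 'a \<Rightarrow> real" where
  "birkhoff_sum T g n x = (\<Sum>i<n. g ((T ^^ i) x))"

definition Fix_pts :: "'a metric \<Rightarrow> ('a \<Rightarrow> 'a) \<Rightarrow> nat \<Rightarrow> 'a set" where
  "Fix_pts m T n = {x \<in> mspace m. (T ^^ n) x = x}"

definition separated_sets :: "'a metric \<Rightarrow> ('a \<Rightarrow> 'a) \<Rightarrow> nat \<Rightarrow> real \<Rightarrow> 'a set set" where
  "separated_sets m T n \<epsilon> = {E. finite E \<and> E \<subseteq> mspace m \<and>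
     (\<forall>x\<in>E. \<forall>y\<in>E. x \<noteq> y \<longrightarrow> (\<exists>i<n. mdist m ((T ^^ i) x) ((T ^^ i) y) > \<epsilon>))}"

text \<open>Topological pressure of a potential, by \<open>(n, \<epsilon>)\<close>-separated sets. For a continuous
  map and a continuous potential on a nonempty compact space the real supremum is over a
  nonempty bounded set of sums, and the limit as \<open>\<epsilon>\<close> tends to 0 exists by monotonicity.
  The value is finite for the full shift. The term \<open>n = 0\<close> is a junk value that does
  not affect the limsup.\<close>

definition topological_pressure :: "'a metric \<Rightarrow> ('a \<Rightarrow> 'a) \<Rightarrow> ('a \<Rightarrow> real) \<Rightarrow> real" where
  "topological_pressure m T \<phi> = real_of_ereal (Lim (at_right 0) (\<lambda>\<epsilon>.
     limsup (\<lambda>n. ereal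
       (ln (SUP E\<in>separated_sets m T n \<epsilon>. \<Sum>x\<in>E. exp (birkhoff_sum T \<phi> n x)) / real n))))"

definition metric_borel :: "'a metric \<Rightarrow> 'a measure" where
  "metric_borel m = sigma (mspace m) {U. openin (mtopology_of m) U}"

definition borel_probs :: "'a metric \<Rightarrow> 'a measure set" where
  "borel_probs m = {\<nu>. prob_space \<nu> \<and> sets \<nu> = sets (metric_borel m)}"

definition invariant_probs :: "'a metric \<Rightarrow> ('a \<Rightarrow> 'a) \<Rightarrow> 'a measure set" where
  "invariant_probs m T = {\<nu> \<in> borel_probs m. T \<in> measurable \<nu> \<nu> \<and>
     (\<forall>A\<in>sets \<nu>. emeasure \<nu> (T -` A \<inter> space \<nu>) = emeasure \<nu> A)}"

definition max_mean :: "'a metric \<Rightarrow> ('a \<Rightarrow> 'a) \<Rightarrow> ('a \<Rightarrow> real) \<Rightarrow> real" where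
  "max_mean m T f = (SUP \<nu>\<in>invariant_probs m T. integral\<^sup>L \<nu> f)"

definition maximizing_probs :: "'a metric \<Rightarrow> ('a \<Rightarrow> 'a) \<Rightarrow> ('a \<Rightarrow> real) \<Rightarrow> 'a measure set" where
  "maximizing_probs m T f =
     {\<nu> \<in> invariant_probs m T. integral\<^sup>L \<nu> f = max_mean m T f}"

definition continuous_fun :: "'a metric \<Rightarrow> ('a \<Rightarrow> real) \<Rightarrow> bool" where
  "continuous_fun m g \<longleftrightarrow> continuous_map (mtopology_of m) euclideanreal g"

definition weak_star_limit :: "'a metric \<Rightarrow> (nat \<Rightarrow> 'a measure) \<Rightarrow> 'a measure \<Rightarrow> bool" where
  "weak_star_limit m \<nu> \<mu> \<longleftrightarrow>
     (\<forall>g. continuous_fun m g \<longrightarrow> (\<lambda>j. integral\<^sup>L (\<nu> j) g) \<longlonglongrightarrow> integral\<^sup>L \<mu> g)"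

text \<open>Invariance of an accumulation point is not part of the definition.\<close>

definition accumulation_probs ::
    "'a metric \<Rightarrow> (real \<Rightarrow> nat \<Rightarrow> 'a measure) \<Rightarrow> 'a measure set" where
  "accumulation_probs m \<Xi> = {\<mu> \<in> borel_probs m. \<exists>c N.
     filterlim c at_top sequentially \<and> filterlim N at_top sequentially \<and>
     weak_star_limit m (\<lambda>j. \<Xi> (c j) (N j)) \<mu>}"

definition total_weight ::
    "'a metric \<Rightarrow> ('a \<Rightarrow> 'a) \<Rightarrow> (nat \<Rightarrow> 'a \<Rightarrow> real) \<Rightarrow> nat \<Rightarrow> real" where
  "total_weight m T w N = (\<Sum>n=1..N. \<Sum>x\<in>Fix_pts m T n. w n x)"

text \<open>The measure giving mass \<open>w n x / (n * total_weight)\<close> to each of the \<open>n\<close> points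
  \<open>(T ^^ i) x\<close>, \<open>i < n\<close>, of the orbit of \<open>x \<in> Fix_pts m T n\<close>, for \<open>1 \<le> n \<le> N\<close>.
  See \<open>integral_orbit_measure\<close> for its integrals.\<close>

definition orbit_measure ::
    "'a metric \<Rightarrow> ('a \<Rightarrow> 'a) \<Rightarrow> (nat \<Rightarrow> 'a \<Rightarrow> real) \<Rightarrow> nat \<Rightarrow> 'a measure" where
  "orbit_measure m T w N =
     distr
       (point_measure (SIGMA n:{1..N}. Fix_pts m T n \<times> {..<n})
         (\<lambda>(n, x, i). ennreal (w n x / (real n * total_weight m T w N))))
       (metric_borel m)
       (\<lambda>(n, x, i). (T ^^ i) x)"

definition pi_measure ::
    "nat \<Rightarrow> real \<Rightarrow> ((nat \<Rightarrow> nat) \<Rightarrow> real) \<Rightarrow> real \<Rightarrow> nat \<Rightarrow> (nat \<Rightarrow> nat) measure" where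
  "pi_measure d \<theta> f c N = orbit_measure (full_shift d \<theta>) shift_map
     (\<lambda>n x. exp (c * birkhoff_sum shift_map f n x
              - real n * topological_pressure (full_shift d \<theta>) shift_map (\<lambda>y. c * f y))) N"

definition eta_measure ::
    "nat \<Rightarrow> real \<Rightarrow> ((nat \<Rightarrow> nat) \<Rightarrow> real) \<Rightarrow> real \<Rightarrow> nat \<Rightarrow> (nat \<Rightarrow> nat) measure" where
  "eta_measure d \<theta> f c N = orbit_measure (full_shift d \<theta>) shift_map
     (\<lambda>n x. exp (c * birkhoff_sum shift_map f n x)) N"

lemma shift_dist_less_iff:
  assumes "0 < \<theta>" "\<theta> < 1"
  shows "shift_dist \<theta> x y < \<theta> ^ k \<longleftrightarrow> (\<forall>i\<le>k. x i = y i)"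
proof (cases "x = y")
  case True
  then show ?thesis using assms by (simp add: shift_dist_def)
next
  case False
  define N where "N = (LEAST N. x N \<noteq> y N)"
  have ex: "\<exists>N. x N \<noteq> y N" using False by auto
  have N: "x N \<noteq> y N" unfolding N_def using ex by (rule LeastI_ex)
  have lt: "x i = y i" if "i < N" for i
    using not_less_Least[OF that[unfolded N_def]] by auto
  have "shift_dist \<theta> x y = \<theta> ^ N" using False by (simp add: shift_dist_def N_def)
  moreover have "\<theta> ^ N < \<theta> ^ k \<longleftrightarrow> k < N"
    using assms by (simp add: power_strict_decreasing_iff)
  moreover have "k < N \<longleftrightarrow> (\<forall>i\<le>k. x i = y i)"
    using N lt by (metis le_less_trans not_le)
  ultimately show ?thesis by simp
qed

lemma shift_dist_ultra:
  assumes "0 < \<theta>" "\<theta> < 1"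
  shows "shift_dist \<theta> x z \<le> max (shift_dist \<theta> x y) (shift_dist \<theta> y z)"
proof (rule ccontr)
  assume "\<not> ?thesis"
  then have a: "shift_dist \<theta> x y < shift_dist \<theta> x z" "shift_dist \<theta> y z < shift_dist \<theta> x z"
    by auto
  have "x \<noteq> z"
    using a assms by (auto simp: shift_dist_def split: if_splits)
  then obtain k where k: "shift_dist \<theta> x z = \<theta> ^ k"
    by (auto simp: shift_dist_def)
  have "\<forall>i\<le>k. x i = y i" "\<forall>i\<le>k. y i = z i"
    using a shift_dist_less_iff[OF assms] by (simp_all add: k)
  then have "shift_dist \<theta> x z < \<theta> ^ k"
    using shift_dist_less_iff[OF assms] by simp
  then show False using k by simp
qed

lemma Metric_space_shift:
  assumes "0 < \<theta>" "\<theta> < 1"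
  shows "Metric_space (shift_space d) (shift_dist \<theta>)"
proof
  fix x y z :: "nat \<Rightarrow> nat"
  show nn: "0 \<le> shift_dist \<theta> x y" for x y
    using assms by (simp add: shift_dist_def)
  show "shift_dist \<theta> x y = shift_dist \<theta> y x"
    by (simp add: shift_dist_def eq_commute)
  show "(shift_dist \<theta> x y = 0) = (x = y)"
    using assms by (simp add: shift_dist_def)
  show "shift_dist \<theta> x z \<le> shift_dist \<theta> x y + shift_dist \<theta> y z"
    using shift_dist_ultra[OF assms, of x z y] nn[of x y] nn[of y z] by linarith
qed

lemma mspace_full_shift:
  "0 < \<theta> \<Longrightarrow> \<theta> < 1 \<Longrightarrow> mspace (full_shift d \<theta>) = shift_space d"
  by (simp add: full_shift_def Metric_space.mspace_metric[OF Metric_space_shift])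

lemma mdist_full_shift:
  "0 < \<theta> \<Longrightarrow> \<theta> < 1 \<Longrightarrow> mdist (full_shift d \<theta>) = shift_dist \<theta>"
  by (simp add: full_shift_def Metric_space.mdist_metric[OF Metric_space_shift])

lemma space_metric_borel [simp]: "space (metric_borel m) = mspace m"
  unfolding metric_borel_def
  by (intro space_measure_of) (metis CollectD PowI openin_subset subsetI topspace_mtopology_of)

lemma sets_metric_borel:
  "sets (metric_borel m) = sigma_sets (mspace m) {U. openin (mtopology_of m) U}"
  unfolding metric_borel_def
  by (intro sets_measure_of) (metis CollectD PowI openin_subset subsetI topspace_mtopology_of)

lemma continuous_fun_measurable:
  assumes "continuous_fun m g"
  shows "g \<in> borel_measurable (metric_borel m)"
proof (rule borel_measurableI)
  fix S :: "real set" assume "open S"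
  then have "openin (mtopology_of m) {x \<in> topspace (mtopology_of m). g x \<in> S}"
    using assms unfolding continuous_fun_def continuous_map_def by auto
  moreover have "{x \<in> topspace (mtopology_of m). g x \<in> S} = g -` S \<inter> space (metric_borel m)"
    by auto
  ultimately show "g -` S \<inter> space (metric_borel m) \<in> sets (metric_borel m)"
    by (auto simp: sets_metric_borel)
qed

lemma continuous_self_map_measurable:
  assumes "continuous_map (mtopology_of m) (mtopology_of m) T"
  shows "T \<in> measurable (metric_borel m) (metric_borel m)"
proof -
  have "T \<in> measurable (metric_borel m) (sigma (mspace m) {U. openin (mtopology_of m) U})"
  proof (rule measurable_measure_of)
    show "{U. openin (mtopology_of m) U} \<subseteq> Pow (mspace m)"
      using openin_subset by fastforce
    show "T \<in> space (metric_borel m) \<rightarrow> mspace m"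
      using assms by (auto simp: continuous_map_def)
    fix U assume "U \<in> {U. openin (mtopology_of m) U}"
    then have "openin (mtopology_of m) {x \<in> topspace (mtopology_of m). T x \<in> U}"
      using assms unfolding continuous_map_def by auto
    moreover have "{x \<in> topspace (mtopology_of m). T x \<in> U} = T -` U \<inter> space (metric_borel m)"
      by auto
    ultimately show "T -` U \<inter> space (metric_borel m) \<in> sets (metric_borel m)"
      by (auto simp: sets_metric_borel)
  qed
  then show ?thesis by (simp add: metric_borel_def)
qed

lemma continuous_map_shift:
  assumes "0 < \<theta>" "\<theta> < 1"
  shows "continuous_map (mtopology_of (full_shift d \<theta>)) (mtopology_of (full_shift d \<theta>)) shift_map"
proof (rule Lipschitz_continuous_imp_continuous_map)
  have "shift_dist \<theta> (shift_map x) (shift_map y) \<le> (1 / \<theta>) * shift_dist \<theta> x y" for x y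
  proof (cases "shift_map x = shift_map y")
    case True
    then show ?thesis using assms by (simp add: shift_dist_def)
  next
    case False
    define k where "k = (LEAST N. shift_map x N \<noteq> shift_map y N)"
    have eq: "shift_dist \<theta> (shift_map x) (shift_map y) = \<theta> ^ k"
      using False by (simp add: shift_dist_def k_def)
    have "\<not> (\<forall>i\<le>k. shift_map x i = shift_map y i)"
      using shift_dist_less_iff[OF assms, of "shift_map x" "shift_map y" k] eq by simp
    then have "\<not> (\<forall>i\<le>Suc k. x i = y i)"
      by (auto simp: shift_map_def)
    then have "\<theta> ^ Suc k \<le> shift_dist \<theta> x y"
      using shift_dist_less_iff[OF assms, of x y "Suc k"] by (metis not_less)
    then show ?thesis using assms eq by (simp add: field_simps)
  qed
  moreover have "shift_map \<in> shift_space d \<rightarrow> shift_space d"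
    by (simp add: shift_space_def shift_map_def)
  ultimately show "Lipschitz_continuous_map (full_shift d \<theta>) (full_shift d \<theta>) shift_map"
    unfolding Lipschitz_continuous_map_def mspace_full_shift[OF assms] mdist_full_shift[OF assms]
    by blast
qed

lemma finite_Fix_shift:
  assumes "0 < \<theta>" "\<theta> < 1" "1 \<le> n"
  shows "finite (Fix_pts (full_shift d \<theta>) shift_map n)"
proof -
  let ?F = "Fix_pts (full_shift d \<theta>) shift_map n"
  have pow: "(shift_map ^^ k) x = (\<lambda>i. x (i + k))" for k x
    by (induction k) (simp_all add: shift_map_def)
  have per: "x (i mod n) = x i" if "x \<in> ?F" for x i
  proof -
    have step: "x (j + n) = x j" for j
      using that pow[of n x] unfolding Fix_pts_def by (simp add: fun_eq_iff)
    have "x (i mod n + q * n) = x (i mod n)" for q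
    proof (induction q)
      case (Suc q)
      then show ?case using step[of "i mod n + q * n"] by (simp add: algebra_simps)
    qed simp
    from this[of "i div n"] show ?thesis by simp
  qed
  have "inj_on (\<lambda>x. map x [0..<n]) ?F"
  proof (rule inj_onI, rule ext)
    fix x y i assume xy: "x \<in> ?F" "y \<in> ?F" and eq: "map x [0..<n] = map y [0..<n]"
    have "i mod n \<in> set [0..<n]" using assms(3) by simp
    then have "x (i mod n) = y (i mod n)" using eq unfolding map_eq_conv by (rule bspec[rotated])
    then show "x i = y i" unfolding per[OF xy(1)] per[OF xy(2)] .
  qed
  moreover have "(\<lambda>x. map x [0..<n]) ` ?F \<subseteq> {l. set l \<subseteq> {1..d} \<and> length l = n}"
    using assms by (auto simp: Fix_pts_def mspace_full_shift shift_space_def)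
  ultimately show ?thesis
    by (rule inj_on_finite) (rule finite_lists_length_eq[OF finite_atLeastAtMost])
qed

lemma Fix_shift_nonempty:
  assumes "0 < \<theta>" "\<theta> < 1" "1 \<le> d"
  shows "(\<lambda>i. 1) \<in> Fix_pts (full_shift d \<theta>) shift_map n"
proof -
  have "(shift_map ^^ n) (\<lambda>i. 1) = (\<lambda>i. 1)"
    by (induction n) (simp_all add: shift_map_def)
  then show ?thesis using assms by (simp add: Fix_pts_def mspace_full_shift shift_space_def)
qed

lemma total_weight_pos:
  assumes "0 < \<theta>" "\<theta> < 1" "1 \<le> d" "1 \<le> N" "\<And>n x. 0 < w n x"
  shows "0 < total_weight (full_shift d \<theta>) shift_map w N"
  unfolding total_weight_def
proof (rule sum_pos)
  fix n assume "n \<in> {1..N}"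
  then show "0 < (\<Sum>x\<in>Fix_pts (full_shift d \<theta>) shift_map n. w n x)"
    using finite_Fix_shift[OF assms(1,2)] Fix_shift_nonempty[OF assms(1,2,3), of n] assms(5)
    by (intro sum_pos) (auto simp del: One_nat_def)
qed (use assms in auto)

lemma Fix_pts_orbit:
  assumes "\<And>x. x \<in> mspace m \<Longrightarrow> T x \<in> mspace m" "x \<in> mspace m"
  shows "(T ^^ i) x \<in> mspace m"
  using assms by (induction i) auto

lemma integral_orbit_measure:
  fixes g :: "'a \<Rightarrow> real"
  assumes fin: "\<And>n. 1 \<le> n \<Longrightarrow> finite (Fix_pts m T n)"
    and T: "\<And>x. x \<in> mspace m \<Longrightarrow> T x \<in> mspace m"
    and w: "\<And>n x. 0 \<le> w n x"
    and g: "g \<in> borel_measurable (metric_borel m)"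
  shows "integral\<^sup>L (orbit_measure m T w N) g =
    (\<Sum>n=1..N. \<Sum>x\<in>Fix_pts m T n. w n x * (birkhoff_sum T g n x / real n)) /
    (\<Sum>n=1..N. \<Sum>x\<in>Fix_pts m T n. w n x)"
proof -
  let ?A = "SIGMA n:{1..N}. Fix_pts m T n \<times> {..<n}"
  let ?Z = "total_weight m T w N"
  let ?p = "\<lambda>(n, x, i). w n x / (real n * ?Z)"
  have Z: "0 \<le> ?Z" unfolding total_weight_def by (intro sum_nonneg w)
  have finA: "finite ?A" using fin by (intro finite_SigmaI) auto
  have pm: "(\<lambda>(n, x, i). ennreal (w n x / (real n * ?Z))) = (\<lambda>a. ennreal (?p a))"
    by auto
  have meas: "(\<lambda>(n, x, i). (T ^^ i) x) \<in>
      measurable (point_measure ?A (\<lambda>a. ennreal (?p a))) (metric_borel m)"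
    by (auto simp: Fix_pts_def intro!: Fix_pts_orbit[OF T])
  have "integral\<^sup>L (orbit_measure m T w N) g = (\<Sum>a\<in>?A. ?p a * g (case a of (n, x, i) \<Rightarrow> (T ^^ i) x))"
    unfolding orbit_measure_def pm
    by (subst integral_distr[OF meas g], subst lebesgue_integral_point_measure_finite[OF finA])
       (use w Z in auto)
  also have "\<dots> = (\<Sum>n=1..N. \<Sum>x\<in>Fix_pts m T n. \<Sum>i<n. w n x / (real n * ?Z) * g ((T ^^ i) x))"
    unfolding sum.cartesian_product using fin
    by (subst sum.Sigma) (auto intro!: sum.cong)
  also have "\<dots> = (\<Sum>n=1..N. \<Sum>x\<in>Fix_pts m T n. w n x * (birkhoff_sum T g n x / real n)) / ?Z"
    unfolding sum_divide_distrib birkhoff_sum_def sum_distrib_left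
    by (intro sum.cong refl) (simp add: field_simps)
  finally show ?thesis by (simp add: total_weight_def)
qed

lemma prob_orbit_measure:
  assumes fin: "\<And>n. 1 \<le> n \<Longrightarrow> finite (Fix_pts m T n)"
    and T: "\<And>x. x \<in> mspace m \<Longrightarrow> T x \<in> mspace m"
    and w: "\<And>n x. 0 \<le> w n x"
    and Z: "0 < total_weight m T w N"
  shows "orbit_measure m T w N \<in> borel_probs m"
proof -
  let ?A = "SIGMA n:{1..N}. Fix_pts m T n \<times> {..<n}"
  let ?p = "(\<lambda>(n, x, i). ennreal (w n x / (real n * total_weight m T w N)))"
  let ?O = "orbit_measure m T w N"
  have finA: "finite ?A" using fin by (intro finite_SigmaI) auto
  have meas: "(\<lambda>(n, x, i). (T ^^ i) x) \<in> measurable (point_measure ?A ?p) (metric_borel m)"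
    by (auto simp: Fix_pts_def intro!: Fix_pts_orbit[OF T])
  have "finite_measure (point_measure ?A ?p)"
    by (rule finite_measureI)
       (use finA in \<open>simp add: space_point_measure emeasure_point_measure_finite
         case_prod_beta ennreal_sum_less_top flip: less_top\<close>)
  then interpret finite_measure ?O
    unfolding orbit_measure_def by (rule finite_measure.finite_measure_distr) (rule meas)
  have "integral\<^sup>L ?O (\<lambda>_. 1) =
    (\<Sum>n=1..N. \<Sum>x\<in>Fix_pts m T n. w n x * (birkhoff_sum T (\<lambda>_. 1) n x / real n)) /
    (\<Sum>n=1..N. \<Sum>x\<in>Fix_pts m T n. w n x)"
    by (rule integral_orbit_measure[OF fin T w]) auto
  also have "\<dots> = (\<Sum>n=1..N. \<Sum>x\<in>Fix_pts m T n. w n x) / (\<Sum>n=1..N. \<Sum>x\<in>Fix_pts m T n. w n x)"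
    by (intro arg_cong2[where f="(/)"] sum.cong refl) (auto simp: birkhoff_sum_def)
  also have "\<dots> = 1" using Z by (simp add: total_weight_def)
  finally have "measure ?O (space ?O) = 1" by simp
  then have "prob_space ?O"
    by (intro prob_spaceI) (simp add: emeasure_eq_measure)
  then show ?thesis by (simp add: borel_probs_def orbit_measure_def)
qed

lemma invariant_orbit_measure:
  assumes fin: "\<And>n. 1 \<le> n \<Longrightarrow> finite (Fix_pts m T n)"
    and T: "T \<in> measurable (metric_borel m) (metric_borel m)"
    and w: "\<And>n x. 0 \<le> w n x"
    and Z: "0 < total_weight m T w N"
  shows "orbit_measure m T w N \<in> invariant_probs m T"
proof -
  let ?O = "orbit_measure m T w N"
  have T': "\<And>x. x \<in> mspace m \<Longrightarrow> T x \<in> mspace m"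
    using measurable_space[OF T] by simp
  have P: "?O \<in> borel_probs m" by (rule prob_orbit_measure[OF fin T' w Z])
  then interpret prob_space ?O by (simp add: borel_probs_def)
  have sets: "sets ?O = sets (metric_borel m)" by (simp add: orbit_measure_def)
  have space: "space ?O = mspace m" by (simp add: orbit_measure_def)
  have TO: "T \<in> measurable ?O ?O" using T unfolding measurable_cong_sets[OF sets sets] .
  have "emeasure ?O (T -` A \<inter> space ?O) = emeasure ?O A" if A: "A \<in> sets ?O" for A
  proof -
    have mA: "A \<in> sets (metric_borel m)" using A sets by simp
    have B: "T -` A \<inter> space ?O \<in> sets ?O" using TO A by (rule measurable_sets)
    have b: "birkhoff_sum T (indicat_real (T -` A \<inter> space ?O)) n x =
        birkhoff_sum T (indicat_real A) n x" if x: "x \<in> Fix_pts m T n" for n x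
    proof -
      have "(T ^^ i) x \<in> mspace m" for i
        using x by (auto simp: Fix_pts_def intro!: Fix_pts_orbit[OF T'])
      then have "birkhoff_sum T (indicat_real (T -` A \<inter> space ?O)) n x
          = (\<Sum>i<n. indicat_real A ((T ^^ Suc i) x))"
        unfolding birkhoff_sum_def space
        by (intro sum.cong refl) (simp add: indicator_def)
      moreover have "(\<Sum>i<n. indicat_real A ((T ^^ Suc i) x)) + indicat_real A x
          = (\<Sum>i<Suc n. indicat_real A ((T ^^ i) x))"
        by (subst sum.lessThan_Suc_shift) simp
      moreover have "(\<Sum>i<Suc n. indicat_real A ((T ^^ i) x))
          = birkhoff_sum T (indicat_real A) n x + indicat_real A ((T ^^ n) x)"
        by (simp add: birkhoff_sum_def)
      ultimately show ?thesis using x by (simp add: Fix_pts_def)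
    qed
    have "integral\<^sup>L ?O (indicat_real (T -` A \<inter> space ?O)) = integral\<^sup>L ?O (indicat_real A)"
    proof -
      have m1: "indicat_real (T -` A \<inter> space ?O) \<in> borel_measurable (metric_borel m)"
        using B sets by (intro borel_measurable_indicator) simp
      have m2: "indicat_real A \<in> borel_measurable (metric_borel m)"
        using mA by (rule borel_measurable_indicator)
      have I: "integral\<^sup>L ?O h =
          (\<Sum>n=1..N. \<Sum>x\<in>Fix_pts m T n. w n x * (birkhoff_sum T h n x / real n)) /
          (\<Sum>n=1..N. \<Sum>x\<in>Fix_pts m T n. w n x)"
        if "h \<in> borel_measurable (metric_borel m)" for h
        using fin T' w that by (rule integral_orbit_measure)
      show ?thesis
        unfolding I[OF m1] I[OF m2]
        by (intro arg_cong2[where f="(/)"] sum.cong refl) (simp add: b)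
    qed
    then have "measure ?O (T -` A \<inter> space ?O) = measure ?O A"
      using A B by simp
    then show ?thesis by (simp add: emeasure_eq_measure)
  qed
  then show ?thesis using P TO by (simp add: invariant_probs_def)
qed

lemma shift_mspace:
  "0 < \<theta> \<Longrightarrow> \<theta> < 1 \<Longrightarrow> x \<in> mspace (full_shift d \<theta>) \<Longrightarrow> shift_map x \<in> mspace (full_shift d \<theta>)"
  by (simp add: mspace_full_shift shift_space_def shift_map_def)

lemma pi_eta_invariant:
  assumes "0 < \<theta>" "\<theta> < 1" "1 \<le> d" "1 \<le> N"
  shows "pi_measure d \<theta> f c N \<in> invariant_probs (full_shift d \<theta>) shift_map"
    and "eta_measure d \<theta> f c N \<in> invariant_probs (full_shift d \<theta>) shift_map"
  unfolding pi_measure_def eta_measure_def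
  by (intro invariant_orbit_measure finite_Fix_shift[OF assms(1,2)] total_weight_pos[OF assms]
      continuous_self_map_measurable continuous_map_shift[OF assms(1,2)]; simp)+

lemma integral_pi_measure:
  fixes f g :: "(nat \<Rightarrow> nat) \<Rightarrow> real" and c :: real
  assumes "0 < \<theta>" "\<theta> < 1" "continuous_fun (full_shift d \<theta>) g"
  defines "F \<equiv> Fix_pts (full_shift d \<theta>) shift_map"
    and "P \<equiv> topological_pressure (full_shift d \<theta>) shift_map (\<lambda>y. c * f y)"
  shows "integral\<^sup>L (pi_measure d \<theta> f c N) g =
    (\<Sum>n=1..N. \<Sum>x\<in>F n. exp (c * birkhoff_sum shift_map f n x - real n * P) *
       (birkhoff_sum shift_map g n x / real n)) /
    (\<Sum>n=1..N. \<Sum>x\<in>F n. exp (c * birkhoff_sum shift_map f n x - real n * P))"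
  unfolding pi_measure_def F_def P_def
  by (intro integral_orbit_measure finite_Fix_shift[OF assms(1,2)] shift_mspace[OF assms(1,2)]
      continuous_fun_measurable[OF assms(3)]) simp_all

lemma integral_eta_measure:
  assumes "0 < \<theta>" "\<theta> < 1" "continuous_fun (full_shift d \<theta>) g"
  defines "F \<equiv> Fix_pts (full_shift d \<theta>) shift_map"
  shows "integral\<^sup>L (eta_measure d \<theta> f c N) g =
    (\<Sum>n=1..N. \<Sum>x\<in>F n. exp (c * birkhoff_sum shift_map f n x) *
       (birkhoff_sum shift_map g n x / real n)) /
    (\<Sum>n=1..N. \<Sum>x\<in>F n. exp (c * birkhoff_sum shift_map f n x))"
  unfolding eta_measure_def F_def
  by (intro integral_orbit_measure finite_Fix_shift[OF assms(1,2)] shift_mspace[OF assms(1,2)]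
      continuous_fun_measurable[OF assms(3)]) simp_all

end

theory Submission
  imports Defs
begin

text \<open>
  Let \<open>beta\<close> be the maximal mean of \<open>f\<close> over periodic orbits. Closing up an orbit segment of any
  length costs at most a constant \<open>C\<close>, so Birkhoff sums of length \<open>n\<close> are at most
  \<open>n * beta + C\<close>; hence \<open>beta\<close> is the maximal invariant mean and
  \<open>c * beta \<le> P (c f) \<le> c * beta + ln d\<close>.
  Both families of measures then concentrate on periodic orbits whose mean is near \<open>beta\<close>.
  For \<open>\<eta>\<close> the periodic points of period \<open>N\<close> with sum at least \<open>N * beta - 1 - C\<close> dominate all
  orbits of length at most \<open>N\<close> with mean below \<open>beta - \<delta>\<close>; here \<open>f > 0\<close> is used. For \<open>\<pi>\<close> the
  orbits with mean below \<open>beta - \<delta>\<close> have total weight of order \<open>exp (- c * \<delta>)\<close>, and a pigeonhole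
  argument gives a single periodic orbit with \<open>S n y \<ge> n * beta - \<delta> / 2\<close>, whose weight is larger.

  Weak* compactness comes from Helly's selection theorem: coding sequences by their base
  \<open>d + 1\<close> expansions embeds the shift space in the real line.
\<close>

subsection \<open>The topology and a real coding of the shift space\<close>

lemma shift_map_funpow: "(shift_map ^^ n) x = (\<lambda>i. x (i + n))"
  by (induction n) (simp_all add: shift_map_def)

lemma shift_space_funpow: "x \<in> shift_space d \<Longrightarrow> (shift_map ^^ n) x \<in> shift_space d"
  by (simp add: shift_map_funpow shift_space_def)

lemma shift_dist_le_power:
  assumes "0 < \<theta>" "\<theta> < 1" "\<And>i. i < k \<Longrightarrow> x i = y i"
  shows "shift_dist \<theta> x y \<le> \<theta> ^ k"
proof (cases k)
  case 0
  then show ?thesis using assms by (simp add: shift_dist_def power_le_one)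
next
  case (Suc n)
  show ?thesis
  proof (cases "x = y")
    case True
    then show ?thesis using assms by (simp add: shift_dist_def)
  next
    case False
    then have "\<exists>N. x N \<noteq> y N" by auto
    then have "x (LEAST N. x N \<noteq> y N) \<noteq> y (LEAST N. x N \<noteq> y N)" by (rule LeastI_ex)
    then have "k \<le> (LEAST N. x N \<noteq> y N)" using assms(3) by (meson not_le)
    then show ?thesis using False assms by (simp add: shift_dist_def power_decreasing)
  qed
qed

lemma shift_space_eq_PiE: "shift_space d = PiE UNIV (\<lambda>_. {1..d})"
  by (auto simp: shift_space_def)

lemma compact_shift_space: "compact (shift_space d)"
proof -
  have "compactin (product_topology (\<lambda>_. euclidean) UNIV) (PiE UNIV (\<lambda>_::nat. {1..d}))"
    by (simp add: compactin_PiE finite_imp_compact)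
  then show ?thesis
    unfolding shift_space_eq_PiE euclidean_product_topology by simp
qed

text \<open>A ball of radius \<open>\<theta> ^ i\<close> fixes the coordinates up to
  \<open>i\<close>, and fixing enough initial coordinates brings the distance below any given
  radius. Working in the product topology makes Tychonoff compactness and ordinary real continuity
  available.\<close>

lemma mtopology_full_shift:
  assumes "0 < \<theta>" "\<theta> < 1"
  shows "mtopology_of (full_shift d \<theta>) = top_of_set (shift_space d)"
proof -
  interpret Metric_space "shift_space d" "shift_dist \<theta>"
    by (rule Metric_space_shift[OF assms])
  have mt: "mtopology_of (full_shift d \<theta>) = mtopology"
    by (simp add: full_shift_def mtopology_of)
  have cont: "continuous_map mtopology (top_of_set (shift_space d)) (\<lambda>x. x)"
  proof -
    have "continuous_map mtopology euclidean (\<lambda>x. x i)" for i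
      unfolding continuous_map_def
    proof (intro conjI allI impI)
      fix U :: "nat set"
      show "openin mtopology {x \<in> topspace mtopology. x i \<in> U}"
        unfolding openin_mtopology
      proof (intro conjI allI impI)
        fix x assume x: "x \<in> {x \<in> topspace mtopology. x i \<in> U}"
        have "mball x (\<theta> ^ i) \<subseteq> {x \<in> topspace mtopology. x i \<in> U}"
          using x by (auto simp: mball_def shift_dist_less_iff[OF assms])
        then show "\<exists>r>0. mball x r \<subseteq> {x \<in> topspace mtopology. x i \<in> U}"
          using assms by (intro exI[of _ "\<theta> ^ i"]) simp
      qed auto
    qed auto
    then have "continuous_map mtopology (product_topology (\<lambda>_. euclidean) UNIV) (\<lambda>x. x)"
      by (simp add: continuous_map_componentwise_UNIV)
    then show ?thesis
      by (simp add: euclidean_product_topology continuous_map_in_subtopology)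
  qed
  have "openin (top_of_set (shift_space d)) U" if U: "openin mtopology U" for U
  proof (subst openin_subopen, safe)
    fix x assume x: "x \<in> U"
    then obtain r where r: "r > 0" "mball x r \<subseteq> U" using U by (auto simp: openin_mtopology)
    obtain k where k: "\<theta> ^ k < r"
      using real_arch_pow_inv[OF r(1) assms(2)] by blast
    let ?V = "PiE UNIV (\<lambda>i. if i < k then {x i} else UNIV)"
    have "open ?V"
    proof (rule open_PiE)
      show "open (if i < k then {x i} else UNIV)" for i
        by (simp add: discrete_topology_class.open_discrete)
      show "finite {i. (if i < k then {x i} else UNIV) \<noteq> UNIV}"
        by (rule finite_subset[of _ "{..<k}"]) (auto split: if_splits)
    qed
    moreover have "x \<in> ?V" by auto
    moreover have "shift_space d \<inter> ?V \<subseteq> mball x r"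
    proof
      fix y assume y: "y \<in> shift_space d \<inter> ?V"
      then have "y i = x i" if "i < k" for i using that by (auto simp: PiE_iff split: if_splits)
      then have "shift_dist \<theta> x y \<le> \<theta> ^ k" using assms by (intro shift_dist_le_power) auto
      then show "y \<in> mball x r"
        using y k x U openin_subset[OF U] by (auto simp: mball_def)
    qed
    ultimately show "\<exists>T. openin (top_of_set (shift_space d)) T \<and> x \<in> T \<and> T \<subseteq> U"
      using x r openin_subset[OF U]
      by (intro exI[of _ "shift_space d \<inter> ?V"]) (auto simp: openin_open)
  qed
  moreover have "openin mtopology U" if U: "openin (top_of_set (shift_space d)) U" for U
  proof -
    have "openin mtopology {x \<in> topspace mtopology. x \<in> U}"
      by (rule openin_continuous_map_preimage[OF cont U])
    moreover have "{x \<in> topspace mtopology. x \<in> U} = U"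
      using openin_subset[OF U] by auto
    ultimately show ?thesis by simp
  qed
  ultimately show ?thesis
    unfolding mt topology_eq by blast
qed

lemma continuous_fun_full_shift:
  assumes "0 < \<theta>" "\<theta> < 1"
  shows "continuous_fun (full_shift d \<theta>) g \<longleftrightarrow> continuous_on (shift_space d) g"
  by (simp add: continuous_fun_def mtopology_full_shift[OF assms])

text \<open>In base \<open>d + 1\<close> a digit that differs outweighs all later digits, which lie in \<open>{1..d}\<close>.\<close>

definition shift_code :: "nat \<Rightarrow> (nat \<Rightarrow> nat) \<Rightarrow> real" where
  "shift_code d x = (\<Sum>i. real (x i) / real (d + 1) ^ i)"

lemma shift_code_summable:
  assumes "x \<in> shift_space d" "1 \<le> d"
  shows "summable (\<lambda>i. real (x i) / real (d + 1) ^ i)"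
proof (rule summable_comparison_test')
  show "summable (\<lambda>i. real d * (1 / real (d + 1)) ^ i)"
    using assms by (intro summable_mult summable_geometric) auto
  show "norm (real (x n) / real (d + 1) ^ n) \<le> real d * (1 / real (d + 1)) ^ n" if "n \<ge> 0" for n
    using assms by (auto simp: shift_space_def power_one_over divide_simps)
qed

text \<open>Terms before \<open>k\<close> cancel, term \<open>k\<close> is split off, and digits in
  \<open>{1..d}\<close> differ by at most \<open>d - 1\<close>, so the tail is dominated by a
  geometric series of ratio \<open>1 / (d + 1)\<close> that sums to the stated bound.\<close>

lemma shift_code_diff:
  assumes x: "x \<in> shift_space d" and y: "y \<in> shift_space d" and d: "1 \<le> d"
    and eq: "\<And>i. i < k \<Longrightarrow> x i = y i"
  shows "\<bar>shift_code d x - shift_code d y - (real (x k) - real (y k)) / real (d + 1) ^ k\<bar>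
    \<le> (real d - 1) / (real d * real (d + 1) ^ k)"
proof -
  define b where "b = real (d + 1)"
  have b: "b > 1" using d by (simp add: b_def)
  define t where "t i = (real (x i) - real (y i)) / b ^ i" for i
  have st: "summable t"
    unfolding t_def diff_divide_distrib b_def
    by (intro summable_diff shift_code_summable x y d)
  have "shift_code d x - shift_code d y = suminf t"
    unfolding shift_code_def t_def diff_divide_distrib b_def
    by (intro suminf_diff shift_code_summable x y d)
  also have "\<dots> = (\<Sum>i. t (i + Suc k)) + (\<Sum>i<Suc k. t i)"
    by (rule suminf_split_initial_segment[OF st])
  also have "(\<Sum>i<Suc k. t i) = t k" using eq by (simp add: t_def)
  finally have "shift_code d x - shift_code d y - t k = (\<Sum>i. t (i + Suc k))" by simp
  moreover have "\<bar>\<Sum>i. t (i + Suc k)\<bar> \<le> (\<Sum>i. (real d - 1) / b ^ Suc k * (1 / b) ^ i)"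
  proof (rule order_trans)
    have bd: "\<bar>t (i + Suc k)\<bar> \<le> (real d - 1) / b ^ Suc k * (1 / b) ^ i" for i
    proof -
      have "x (i + Suc k) \<in> {1..d}" "y (i + Suc k) \<in> {1..d}"
        using x y by (auto simp: shift_space_def)
      then have "\<bar>real (x (i + Suc k)) - real (y (i + Suc k))\<bar> \<le> real d - 1"
        by auto
      then have "\<bar>t (i + Suc k)\<bar> \<le> (real d - 1) / b ^ (i + Suc k)"
        using b unfolding t_def abs_divide by (intro frac_le) auto
      also have "\<dots> = (real d - 1) / b ^ Suc k * (1 / b) ^ i"
        by (simp add: power_add power_one_over)
      finally show ?thesis .
    qed
    have sg: "summable (\<lambda>i. (real d - 1) / b ^ Suc k * (1 / b) ^ i)"
      using b by (intro summable_mult summable_geometric) auto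
    have sa: "summable (\<lambda>i. \<bar>t (i + Suc k)\<bar>)"
      by (rule summable_comparison_test'[OF sg]) (use bd in auto)
    show "\<bar>\<Sum>i. t (i + Suc k)\<bar> \<le> (\<Sum>i. \<bar>t (i + Suc k)\<bar>)" by (rule summable_rabs[OF sa])
    show "(\<Sum>i. \<bar>t (i + Suc k)\<bar>) \<le> (\<Sum>i. (real d - 1) / b ^ Suc k * (1 / b) ^ i)"
      by (rule suminf_le[OF bd sa sg])
  qed
  moreover have "(\<Sum>i. (real d - 1) / b ^ Suc k * (1 / b) ^ i) = (real d - 1) / (real d * b ^ k)"
  proof -
    have "(\<Sum>i. (1 / b) ^ i) = 1 / (1 - 1 / b)" using b by (intro suminf_geometric) auto
    also have "\<dots> = b / real d" using b by (simp add: b_def field_simps)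
    finally have s: "(\<Sum>i. (1 / b) ^ i) = b / real d" .
    have "(\<Sum>i. (real d - 1) / b ^ Suc k * (1 / b) ^ i) = (real d - 1) / b ^ Suc k * (\<Sum>i. (1 / b) ^ i)"
      using b by (intro suminf_mult summable_geometric) auto
    also have "\<dots> = (real d - 1) / (real d * b ^ k)"
      using b d unfolding s by (simp add: field_simps)
    finally show ?thesis .
  qed
  ultimately show ?thesis by (simp add: t_def b_def)
qed

text \<open>At the first differing digit the leading term is at least
  \<open>1 / (d + 1) ^ k\<close>, while the tail reaches at most the fraction
  \<open>(d - 1) / d\<close> of that, so the two cannot cancel.\<close>

lemma inj_on_shift_code:
  assumes d: "1 \<le> d"
  shows "inj_on (shift_code d) (shift_space d)"
proof (rule inj_onI, rule ccontr)
  fix x y assume x: "x \<in> shift_space d" and y: "y \<in> shift_space d"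
    and eq: "shift_code d x = shift_code d y" and ne: "x \<noteq> y"
  define k where "k = (LEAST k. x k \<noteq> y k)"
  have "\<exists>k. x k \<noteq> y k" using ne by auto
  then have k: "x k \<noteq> y k" unfolding k_def by (rule LeastI_ex)
  have lt: "x i = y i" if "i < k" for i
    using not_less_Least[OF that[unfolded k_def]] by auto
  have "\<bar>(real (x k) - real (y k)) / real (d + 1) ^ k\<bar> \<le> (real d - 1) / (real d * real (d + 1) ^ k)"
    using shift_code_diff[OF x y d lt] eq by simp
  then have "\<bar>real (x k) - real (y k)\<bar> * real d \<le> real d - 1"
    using d by (simp add: abs_divide divide_simps split: if_splits)
  moreover have "\<bar>real (x k) - real (y k)\<bar> \<ge> 1" using k by linarith
  then have "\<bar>real (x k) - real (y k)\<bar> * real d \<ge> 1 * real d" by (rule mult_right_mono) simp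
  ultimately show False by simp
qed

lemma continuous_on_shift_code:
  assumes d: "1 \<le> d"
  shows "continuous_on (shift_space d) (shift_code d)"
  unfolding shift_code_def
proof (rule uniform_limit_theorem)
  have s: "summable (\<lambda>i. real d * (1 / real (d + 1)) ^ i)"
    using d by (intro summable_mult summable_geometric) auto
  have c: "continuous_on UNIV (\<lambda>x::nat \<Rightarrow> nat. x i)" for i
    by (rule continuous_on_product_coordinates)
  have "continuous_on A (real \<circ> (\<lambda>x::nat \<Rightarrow> nat. x i))" for A i
    by (rule continuous_on_compose[OF continuous_on_subset[OF c]]) auto
  then have c': "continuous_on A (\<lambda>x::nat \<Rightarrow> nat. real (x i))" for A i
    by (simp add: o_def)
  show "\<forall>\<^sub>F n in sequentially. continuous_on (shift_space d)
      (\<lambda>x. \<Sum>i<n. real (x i) / real (d + 1) ^ i)"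
    using d by (intro always_eventually allI continuous_intros c') auto
  show "uniform_limit (shift_space d) (\<lambda>n x. \<Sum>i<n. real (x i) / real (d + 1) ^ i)
      (\<lambda>x. \<Sum>i. real (x i) / real (d + 1) ^ i) sequentially"
    by (rule Weierstrass_m_test[OF _ s])
       (auto simp: shift_space_def power_one_over divide_simps)
qed auto

subsection \<open>Weak* limits\<close>

lemma borel_probs_sets_space:
  assumes "\<nu> \<in> borel_probs m"
  shows "sets \<nu> = sets (metric_borel m)" "space \<nu> = mspace m"
  using assms sets_eq_imp_space_eq[of \<nu> "metric_borel m"] by (auto simp: borel_probs_def)

lemma continuous_fun_borel_measurable:
  assumes "continuous_fun m g" "\<nu> \<in> borel_probs m"
  shows "g \<in> borel_measurable \<nu>"
  using continuous_fun_measurable[OF assms(1)] borel_probs_sets_space(1)[OF assms(2)]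
  by (simp cong: measurable_cong_sets)

lemma continuous_fun_bounded:
  assumes "0 < \<theta>" "\<theta> < 1" "continuous_fun (full_shift d \<theta>) g"
  obtains B where "0 \<le> B" "\<And>x. x \<in> shift_space d \<Longrightarrow> \<bar>g x\<bar> \<le> B"
proof -
  have "continuous_on (shift_space d) g"
    using assms by (simp add: continuous_fun_full_shift)
  then have "bounded (g ` shift_space d)"
    using compact_continuous_image compact_imp_bounded compact_shift_space by blast
  then show ?thesis using that by (auto simp: bounded_pos intro: less_imp_le)
qed

lemma continuous_fun_integrable:
  assumes "0 < \<theta>" "\<theta> < 1" "continuous_fun (full_shift d \<theta>) g" "\<nu> \<in> borel_probs (full_shift d \<theta>)"
  shows "integrable \<nu> g"
proof -
  interpret prob_space \<nu> using assms by (simp add: borel_probs_def)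
  obtain B where "\<And>x. x \<in> shift_space d \<Longrightarrow> \<bar>g x\<bar> \<le> B"
    using continuous_fun_bounded[OF assms(1-3)] by blast
  then show ?thesis
    using continuous_fun_borel_measurable[OF assms(3,4)] borel_probs_sets_space[OF assms(4)] assms
    by (intro integrable_const_bound[of _ B]) (auto simp: mspace_full_shift)
qed

section \<open>Transfer between the shift space and the real line\<close>

lemma continuous_fun_shift_code:
  assumes "0 < \<theta>" "\<theta> < 1" "1 \<le> d"
  shows "continuous_fun (full_shift d \<theta>) (shift_code d)"
  using assms by (simp add: continuous_fun_full_shift continuous_on_shift_code)

lemma continuous_fun_compose:
  assumes "0 < \<theta>" "\<theta> < 1" "1 \<le> d" "continuous_on UNIV \<phi>"
  shows "continuous_fun (full_shift d \<theta>) (\<lambda>x. \<phi> (shift_code d x))"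
  using assms
  by (auto simp: continuous_fun_full_shift
      intro!: continuous_on_compose2[OF assms(4)] continuous_on_shift_code)

lemma compact_shift_code_image:
  "1 \<le> d \<Longrightarrow> compact (shift_code d ` shift_space d)"
  by (intro compact_continuous_image continuous_on_shift_code compact_shift_space)

text \<open>The constant sequence 1 off the image of the code makes the inverse total with values in
  the shift space; the laws of coded measures and their weak limits give the complement of the image
  no mass.\<close>

definition shift_decode :: "nat \<Rightarrow> real \<Rightarrow> nat \<Rightarrow> nat" where
  "shift_decode d t = (if t \<in> shift_code d ` shift_space d
     then inv_into (shift_space d) (shift_code d) t else (\<lambda>_. 1))"

lemma shift_decode_code [simp]:
  "1 \<le> d \<Longrightarrow> x \<in> shift_space d \<Longrightarrow> shift_decode d (shift_code d x) = x"
  by (simp add: shift_decode_def inj_on_shift_code)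

lemma shift_decode_in: "1 \<le> d \<Longrightarrow> shift_decode d t \<in> shift_space d"
  by (auto simp: shift_decode_def inv_into_into) (simp add: shift_space_def)

lemma continuous_on_shift_decode:
  assumes "1 \<le> d"
  shows "continuous_on (shift_code d ` shift_space d) (shift_decode d)"
  using assms by (intro continuous_on_inv continuous_on_shift_code compact_shift_space) auto

text \<open>The image of the code is closed; the decoder is continuous on it and constant off it, so
  preimages of open sets split into two Borel pieces.\<close>

lemma measurable_shift_decode:
  assumes "0 < \<theta>" "\<theta> < 1" "1 \<le> d"
  shows "shift_decode d \<in> measurable borel (metric_borel (full_shift d \<theta>))"
proof -
  let ?K = "shift_code d ` shift_space d"
  let ?X = "full_shift d \<theta>"
  have K: "closed ?K" by (intro compact_imp_closed compact_shift_code_image assms)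
  have "shift_decode d \<in> measurable borel (sigma (mspace ?X) {U. openin (mtopology_of ?X) U})"
  proof (rule measurable_measure_of)
    show "{U. openin (mtopology_of ?X) U} \<subseteq> Pow (mspace ?X)"
      using openin_subset by fastforce
    show "shift_decode d \<in> space borel \<rightarrow> mspace ?X"
      using assms by (auto simp: mspace_full_shift shift_decode_in)
    fix U assume "U \<in> {U. openin (mtopology_of ?X) U}"
    then have "openin (top_of_set (shift_space d)) U"
      by (simp add: mtopology_full_shift assms)
    then have "openin (top_of_set ?K) (?K \<inter> shift_decode d -` U)"
      using continuous_on_shift_decode[OF assms(3)] assms
      by (intro continuous_openin_preimage[where T="shift_space d"]) (auto simp: shift_decode_in)
    then have "?K \<inter> shift_decode d -` U \<in> sets borel"
      using K by (auto simp: openin_open)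
    moreover have "- ?K \<inter> shift_decode d -` U = (if (\<lambda>_. 1) \<in> U then - ?K else {})"
      by (auto simp: shift_decode_def)
    then have "- ?K \<inter> shift_decode d -` U \<in> sets borel"
      using K by (simp add: borel_comp)
    moreover have "shift_decode d -` U \<inter> space borel
        = (?K \<inter> shift_decode d -` U) \<union> (- ?K \<inter> shift_decode d -` U)"
      by auto
    ultimately show "shift_decode d -` U \<inter> space borel \<in> sets borel"
      by (metis sets.Un)
  qed
  then show ?thesis by (simp add: metric_borel_def)
qed

lemma measurable_shift_code:
  assumes "0 < \<theta>" "\<theta> < 1" "1 \<le> d" "\<nu> \<in> borel_probs (full_shift d \<theta>)"
  shows "shift_code d \<in> borel_measurable \<nu>"
  using assms continuous_fun_borel_measurable continuous_fun_shift_code by blast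

lemma real_distribution_shift_code:
  assumes "0 < \<theta>" "\<theta> < 1" "1 \<le> d" "\<nu> \<in> borel_probs (full_shift d \<theta>)"
  shows "real_distribution (distr \<nu> borel (shift_code d))"
proof -
  interpret prob_space \<nu> using assms by (simp add: borel_probs_def)
  show ?thesis
    using measurable_shift_code[OF assms]
    by (simp add: real_distribution_distr)
qed

text \<open>Coding loses nothing: decoding after coding is the identity on the shift space, so
  questions about measures there can be moved to their laws on the line.\<close>

lemma distr_decode_code:
  assumes "0 < \<theta>" "\<theta> < 1" "1 \<le> d" and \<nu>: "\<nu> \<in> borel_probs (full_shift d \<theta>)"
  shows "distr (distr \<nu> borel (shift_code d)) (metric_borel (full_shift d \<theta>)) (shift_decode d) = \<nu>"
proof -
  have "distr (distr \<nu> borel (shift_code d)) (metric_borel (full_shift d \<theta>)) (shift_decode d)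
      = distr \<nu> (metric_borel (full_shift d \<theta>)) (shift_decode d \<circ> shift_code d)"
    using assms by (intro distr_distr measurable_shift_decode measurable_shift_code)
  also have "\<dots> = distr \<nu> \<nu> (\<lambda>x. x)"
    using assms borel_probs_sets_space[OF \<nu>]
    by (intro distr_cong) (auto simp: mspace_full_shift)
  finally show ?thesis by (simp add: distr_id)
qed

text \<open>The real and imaginary parts of the characteristic function of a coded law are integrals
  of the continuous functions \<open>cos (t * shift_code d x)\<close> and
  \<open>sin (t * shift_code d x)\<close>. Levy's uniqueness theorem identifies the laws, and
  decoding the measures.\<close>

lemma borel_probs_eqI:
  assumes th: "0 < \<theta>" "\<theta> < 1" and d: "1 \<le> d"
    and \<mu>: "\<mu> \<in> borel_probs (full_shift d \<theta>)" and \<nu>: "\<nu> \<in> borel_probs (full_shift d \<theta>)"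
    and eq: "\<And>g. continuous_fun (full_shift d \<theta>) g \<Longrightarrow> integral\<^sup>L \<mu> g = integral\<^sup>L \<nu> g"
  shows "\<mu> = \<nu>"
proof -
  let ?D = "\<lambda>\<nu>. distr \<nu> borel (shift_code d)"
  have "char (?D \<mu>) = char (?D \<nu>)"
  proof
    fix t :: real
    have c: "char (?D \<rho>) t =
        Complex (integral\<^sup>L \<rho> (\<lambda>x. cos (t * shift_code d x))) (integral\<^sup>L \<rho> (\<lambda>x. sin (t * shift_code d x)))"
      if \<rho>: "\<rho> \<in> borel_probs (full_shift d \<theta>)" for \<rho>
    proof -
      have m: "shift_code d \<in> borel_measurable \<rho>" by (rule measurable_shift_code[OF th d \<rho>])
      interpret prob_space \<rho> using \<rho> by (simp add: borel_probs_def)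
      have "char (?D \<rho>) t = (CLINT x|\<rho>. iexp (t * shift_code d x))"
        unfolding char_def using m by (subst integral_distr) auto
      moreover have "integrable \<rho> (\<lambda>x. iexp (t * shift_code d x))"
        using m by (intro integrable_const_bound[of _ 1]) auto
      ultimately show ?thesis
        by (simp add: complex_eq_iff flip: integral_Re integral_Im)
           (simp add: cos_of_real Re_exp Im_exp)
    qed
    have "continuous_fun (full_shift d \<theta>) (\<lambda>x. cos (t * shift_code d x))"
      "continuous_fun (full_shift d \<theta>) (\<lambda>x. sin (t * shift_code d x))"
      by (intro continuous_fun_compose[OF th d] continuous_intros)+
    then show "char (?D \<mu>) t = char (?D \<nu>) t"
      using eq by (simp add: c \<mu> \<nu>)
  qed
  then have "?D \<mu> = ?D \<nu>"
    by (rule Levy_uniqueness[OF real_distribution_shift_code[OF th d \<mu>]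
          real_distribution_shift_code[OF th d \<nu>]])
  then show ?thesis
    by (metis distr_decode_code[OF th d \<mu>] distr_decode_code[OF th d \<nu>])
qed

text \<open>The coded laws sit in one compact set, hence are tight and have a weakly convergent
  subsequence. Its limit is shown to be carried by the same compact set and is then decoded.\<close>

lemma weak_star_convergent_subsequence:
  fixes \<nu> :: "nat \<Rightarrow> (nat \<Rightarrow> nat) measure"
  assumes th: "0 < \<theta>" "\<theta> < 1" and d: "1 \<le> d"
    and \<nu>: "\<And>j. \<nu> j \<in> borel_probs (full_shift d \<theta>)"
  obtains r \<mu> where "strict_mono r" "\<mu> \<in> borel_probs (full_shift d \<theta>)"
    "weak_star_limit (full_shift d \<theta>) (\<lambda>j. \<nu> (r j)) \<mu>"
proof -
  let ?X = "full_shift d \<theta>"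
  let ?K = "shift_code d ` shift_space d"
  define D where "D j = distr (\<nu> j) borel (shift_code d)" for j
  have sp: "space (\<nu> j) = shift_space d" for j
    using borel_probs_sets_space[OF \<nu>] th by (simp add: mspace_full_shift)
  have mc: "shift_code d \<in> borel_measurable (\<nu> j)" for j
    by (rule measurable_shift_code[OF th d \<nu>])
  have rd: "real_distribution (D j)" for j
    unfolding D_def by (rule real_distribution_shift_code[OF th d \<nu>])
  have K: "compact ?K" by (rule compact_shift_code_image[OF d])
  have Kne: "?K \<noteq> {}" using shift_decode_in[OF d] by blast
  obtain B where B: "B > 0" "\<And>t. t \<in> ?K \<Longrightarrow> \<bar>t\<bar> \<le> B"
    using compact_imp_bounded[OF K] by (auto simp: bounded_pos)
  have "tight D"
    unfolding tight_def
  proof (intro conjI allI impI rd)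
    fix e :: real assume "e > 0"
    have "measure (D n) {-B-1<..B} = 1" for n
    proof -
      interpret prob_space "\<nu> n" using \<nu> by (simp add: borel_probs_def)
      have "shift_code d -` {-B-1<..B} \<inter> space (\<nu> n) = space (\<nu> n)"
        using B(2) by (force simp: sp)
      then show ?thesis
        unfolding D_def using mc by (simp add: measure_distr prob_space)
    qed
    then show "\<exists>a b. a < b \<and> (\<forall>n. 1 - e < measure (D n) {a<..b})"
      using \<open>e > 0\<close> B by (intro exI[of _ "-B-1"] exI[of _ B]) auto
  qed
  then obtain r M where r: "strict_mono r" and M: "real_distribution M"
    and w: "weak_conv_m (D \<circ> id \<circ> r) M"
    using tight_imp_convergent_subsubsequence[of D id] by (auto simp: strict_mono_def)
  interpret M: real_distribution M by (rule M)
  have conv: "(\<lambda>j. integral\<^sup>L (\<nu> (r j)) (\<lambda>x. \<phi> (shift_code d x))) \<longlonglongrightarrow> integral\<^sup>L M \<phi>"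
    if c: "continuous_on UNIV \<phi>" and b: "\<And>t. \<bar>\<phi> t\<bar> \<le> C" for \<phi> :: "real \<Rightarrow> real" and C
  proof -
    have "(\<lambda>j. integral\<^sup>L ((D \<circ> id \<circ> r) j) \<phi>) \<longlonglongrightarrow> integral\<^sup>L M \<phi>"
      by (rule weak_conv_imp_integral_bdd_continuous_conv[of "D \<circ> id \<circ> r" M \<phi> C])
         (use rd M w c b in \<open>auto simp: continuous_on_eq_continuous_at\<close>)
    moreover have "integral\<^sup>L ((D \<circ> id \<circ> r) j) \<phi> = integral\<^sup>L (\<nu> (r j)) (\<lambda>x. \<phi> (shift_code d x))" for j
      using mc borel_measurable_continuous_onI[OF c] by (simp add: D_def integral_distr)
    ultimately show ?thesis by simp
  qed
  have AE_K: "AE t in M. t \<in> ?K"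
  proof -
    \<comment> \<open>This bounded continuous function vanishes exactly on the closed set
      \<open>?K\<close>, so its integrals are 0 along the sequence and in the limit, which forces
      \<open>M\<close> to be carried by \<open>?K\<close>.\<close>
    define \<phi> where "\<phi> t = min 1 (infdist t ?K)" for t
    have c\<phi>: "continuous_on UNIV \<phi>" unfolding \<phi>_def by (intro continuous_intros)
    have b\<phi>: "0 \<le> \<phi> t" "\<bar>\<phi> t\<bar> \<le> 1" for t
      by (auto simp: \<phi>_def infdist_nonneg)
    have "integral\<^sup>L (\<nu> j) (\<lambda>x. \<phi> (shift_code d x)) = integral\<^sup>L (\<nu> j) (\<lambda>_. 0)" for j
      by (intro Bochner_Integration.integral_cong refl) (simp add: \<phi>_def sp)
    then have "integral\<^sup>L M \<phi> = 0"
      using conv[OF c\<phi> b\<phi>(2)] by (simp add: LIMSEQ_const_iff)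
    moreover have "integrable M \<phi>"
      using b\<phi> borel_measurable_continuous_onI[OF c\<phi>]
      by (intro M.integrable_const_bound[of _ 1]) auto
    ultimately have "AE t in M. \<phi> t = 0"
      using integral_nonneg_eq_0_iff_AE[of M \<phi>] b\<phi> by simp
    then show ?thesis
    proof eventually_elim
      case (elim t)
      then have "infdist t ?K = 0" by (auto simp: \<phi>_def min_def split: if_splits)
      then show ?case
        using in_closed_iff_infdist_zero[OF compact_imp_closed[OF K] Kne] by blast
    qed
  qed
  define \<mu> where "\<mu> = distr M (metric_borel ?X) (shift_decode d)"
  have md: "shift_decode d \<in> measurable M (metric_borel ?X)"
    using measurable_shift_decode[OF th d] by simp
  have \<mu>: "\<mu> \<in> borel_probs ?X"
    unfolding borel_probs_def \<mu>_def using M.prob_space_distr[OF md] by simp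
  have "weak_star_limit ?X (\<lambda>j. \<nu> (r j)) \<mu>"
    unfolding weak_star_limit_def
  proof (intro allI impI)
    fix g assume g: "continuous_fun ?X g"
    obtain C where C: "0 \<le> C" "\<And>x. x \<in> shift_space d \<Longrightarrow> \<bar>g x\<bar> \<le> C"
      using continuous_fun_bounded[OF th g] by blast
    have "continuous_on (shift_space d) g" using g th by (simp add: continuous_fun_full_shift)
    then have "continuous_on ?K (\<lambda>t. g (shift_decode d t))"
      by (rule continuous_on_compose2[OF _ continuous_on_shift_decode[OF d]])
         (use shift_decode_in[OF d] in blast)
    moreover have "closedin (top_of_set UNIV) ?K" using compact_imp_closed[OF K] by simp
    moreover have "norm (g (shift_decode d t)) \<le> C" for t
      using C(2)[OF shift_decode_in[OF d]] by simp
    \<comment> \<open>Convergence is known for functions of the code that are bounded and continuous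
      on the whole line, so the decoded test function is extended from \<open>?K\<close> by Tietze
      with the same bound; the two can differ only off \<open>?K\<close>, a null set for
      \<open>M\<close>.\<close>
    ultimately obtain \<psi> where \<psi>: "continuous_on UNIV \<psi>"
        "\<And>t. t \<in> ?K \<Longrightarrow> \<psi> t = g (shift_decode d t)" "\<And>t. norm (\<psi> t) \<le> C"
      using Tietze[OF _ _ C(1)] by (metis UNIV_I)
    have "integral\<^sup>L \<mu> g = integral\<^sup>L M (\<lambda>t. g (shift_decode d t))"
      unfolding \<mu>_def using md continuous_fun_measurable[OF g] by (rule integral_distr)
    also have "\<dots> = integral\<^sup>L M \<psi>"
    proof (rule integral_cong_AE)
      show "(\<lambda>t. g (shift_decode d t)) \<in> borel_measurable M"
        using measurable_compose[OF md continuous_fun_measurable[OF g]] .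
      show "\<psi> \<in> borel_measurable M"
        using borel_measurable_continuous_onI[OF \<psi>(1)] by simp
      show "AE t in M. g (shift_decode d t) = \<psi> t"
        using AE_K by eventually_elim (simp add: \<psi>)
    qed
    finally have "(\<lambda>j. integral\<^sup>L (\<nu> (r j)) (\<lambda>x. \<psi> (shift_code d x))) \<longlonglongrightarrow> integral\<^sup>L \<mu> g"
      using conv[OF \<psi>(1), of C] \<psi>(3) by simp
    moreover have "integral\<^sup>L (\<nu> j) (\<lambda>x. \<psi> (shift_code d x)) = integral\<^sup>L (\<nu> j) g" for j
      using d by (intro Bochner_Integration.integral_cong refl) (simp add: \<psi> sp)
    ultimately show "(\<lambda>j. integral\<^sup>L (\<nu> (r j)) g) \<longlonglongrightarrow> integral\<^sup>L \<mu> g" by simp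
  qed
  then show ?thesis using that r \<mu> by blast
qed

text \<open>Testing against \<open>g\<close> and against \<open>g\<close> composed with the shift
  gives equal integrals along the sequence, hence in the limit, and continuous functions determine
  the measure. Invariance is asked only eventually because the orbit measures have it for
  \<open>1 \<le> N\<close>.\<close>

lemma weak_star_limit_invariant:
  assumes th: "0 < \<theta>" "\<theta> < 1" and d: "1 \<le> d"
    and \<mu>: "\<mu> \<in> borel_probs (full_shift d \<theta>)"
    and inv: "eventually (\<lambda>j. \<nu> j \<in> invariant_probs (full_shift d \<theta>) shift_map) sequentially"
    and lim: "weak_star_limit (full_shift d \<theta>) \<nu> \<mu>"
  shows "\<mu> \<in> invariant_probs (full_shift d \<theta>) shift_map"
proof -
  let ?X = "full_shift d \<theta>"
  have mT: "shift_map \<in> measurable (metric_borel ?X) (metric_borel ?X)"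
    by (intro continuous_self_map_measurable continuous_map_shift th)
  have T: "shift_map \<in> measurable \<rho> \<rho>" if "\<rho> \<in> borel_probs ?X" for \<rho>
    using mT borel_probs_sets_space(1)[OF that] by (simp cong: measurable_cong_sets)
  interpret prob_space \<mu> using \<mu> by (simp add: borel_probs_def)
  have D: "distr \<mu> \<mu> shift_map \<in> borel_probs ?X"
    using prob_space_distr[OF T[OF \<mu>]] \<mu> by (simp add: borel_probs_def)
  have "distr \<mu> \<mu> shift_map = \<mu>"
  proof (rule borel_probs_eqI[OF th d D \<mu>])
    fix g assume g: "continuous_fun ?X g"
    have gT: "continuous_fun ?X (\<lambda>x. g (shift_map x))"
      using continuous_map_compose[OF continuous_map_shift[OF th] g[unfolded continuous_fun_def]]
      by (simp add: continuous_fun_def o_def)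
    have "\<forall>\<^sub>F j in sequentially. integral\<^sup>L (\<nu> j) (\<lambda>x. g (shift_map x)) = integral\<^sup>L (\<nu> j) g"
      using inv
    proof eventually_elim
      case (elim j)
      then have b: "\<nu> j \<in> borel_probs ?X" by (simp add: invariant_probs_def)
      have "distr (\<nu> j) (\<nu> j) shift_map = \<nu> j"
        using elim by (intro measure_eqI) (auto simp: emeasure_distr invariant_probs_def)
      then show ?case
        using integral_distr[OF T[OF b] continuous_fun_borel_measurable[OF g b]] by simp
    qed
    moreover have "(\<lambda>j. integral\<^sup>L (\<nu> j) (\<lambda>x. g (shift_map x))) \<longlonglongrightarrow> integral\<^sup>L \<mu> (\<lambda>x. g (shift_map x))"
      using lim gT by (simp add: weak_star_limit_def)
    ultimately have "(\<lambda>j. integral\<^sup>L (\<nu> j) g) \<longlonglongrightarrow> integral\<^sup>L \<mu> (\<lambda>x. g (shift_map x))"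
      by (simp add: tendsto_cong)
    moreover have "(\<lambda>j. integral\<^sup>L (\<nu> j) g) \<longlonglongrightarrow> integral\<^sup>L \<mu> g"
      using lim g by (simp add: weak_star_limit_def)
    ultimately have "integral\<^sup>L \<mu> (\<lambda>x. g (shift_map x)) = integral\<^sup>L \<mu> g"
      by (rule LIMSEQ_unique)
    then show "integral\<^sup>L (distr \<mu> \<mu> shift_map) g = integral\<^sup>L \<mu> g"
      using integral_distr[OF T[OF \<mu>] continuous_fun_borel_measurable[OF g \<mu>]] by simp
  qed
  then have "emeasure \<mu> (shift_map -` A \<inter> space \<mu>) = emeasure \<mu> A" if "A \<in> sets \<mu>" for A
    using emeasure_distr[OF T[OF \<mu>] that] by simp
  then show ?thesis using \<mu> T[OF \<mu>] by (simp add: invariant_probs_def)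
qed

subsection \<open>Periodic orbits and the maximal mean\<close>

lemma birkhoff_sum_add:
  "birkhoff_sum T g (a + b) x = birkhoff_sum T g a x + birkhoff_sum T g b ((T ^^ a) x)"
  by (induction b) (simp_all add: birkhoff_sum_def funpow_add add.commute[of a])

lemma birkhoff_sum_periodic:
  assumes "(T ^^ m) y = y"
  shows "birkhoff_sum T g m ((T ^^ k) y) = birkhoff_sum T g m y"
proof -
  have "birkhoff_sum T g k y + birkhoff_sum T g m ((T ^^ k) y) = birkhoff_sum T g (k + m) y"
    by (simp add: birkhoff_sum_add)
  also have "\<dots> = birkhoff_sum T g (m + k) y" by (simp add: add.commute)
  also have "\<dots> = birkhoff_sum T g m y + birkhoff_sum T g k y"
    by (simp add: birkhoff_sum_add assms)
  finally show ?thesis by simp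
qed

text \<open>After swapping the sums, each of the \<open>n\<close> inner sums runs once through the
  \<open>m\<close> orbit points. This allows averaging sums of length \<open>n\<close> over an orbit
  of unrelated period.\<close>

lemma sum_birkhoff_sum_orbit:
  assumes "(T ^^ m) y = y"
  shows "(\<Sum>i<m. birkhoff_sum T g n ((T ^^ i) y)) = real n * birkhoff_sum T g m y"
proof -
  have "(\<Sum>i<m. birkhoff_sum T g n ((T ^^ i) y)) = (\<Sum>k<n. \<Sum>i<m. g ((T ^^ k) ((T ^^ i) y)))"
    unfolding birkhoff_sum_def by (rule sum.swap)
  also have "\<dots> = (\<Sum>k<n. birkhoff_sum T g m ((T ^^ k) y))"
    unfolding birkhoff_sum_def
    by (intro sum.cong refl) (metis add.commute comp_apply funpow_add)
  also have "\<dots> = real n * birkhoff_sum T g m y"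
    by (simp add: birkhoff_sum_periodic[OF assms])
  finally show ?thesis .
qed

lemma card_Fix_shift_le:
  assumes "0 < \<theta>" "\<theta> < 1" "1 \<le> n"
  shows "card (Fix_pts (full_shift d \<theta>) shift_map n) \<le> d ^ n"
proof -
  let ?F = "Fix_pts (full_shift d \<theta>) shift_map n"
  have per: "x i = x (i mod n)" if "x \<in> ?F" for x i
  proof -
    have step: "x (j + n) = x j" for j
      using that by (simp add: Fix_pts_def shift_map_funpow fun_eq_iff)
    have "x (i mod n + q * n) = x (i mod n)" for q
    proof (induction q)
      case (Suc q)
      then show ?case using step[of "i mod n + q * n"] by (simp add: algebra_simps)
    qed simp
    from this[of "i div n"] show ?thesis by simp
  qed
  have "inj_on (\<lambda>x. map x [0..<n]) ?F"
  proof (rule inj_onI, rule ext)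
    fix x y i assume xy: "x \<in> ?F" "y \<in> ?F" and eq: "map x [0..<n] = map y [0..<n]"
    have "x (i mod n) = y (i mod n)" using eq assms(3) by (simp add: map_eq_conv)
    then show "x i = y i" using per[OF xy(1), of i] per[OF xy(2), of i] by simp
  qed
  moreover have "(\<lambda>x. map x [0..<n]) ` ?F \<subseteq> {l. set l \<subseteq> {1..d} \<and> length l = n}"
    using assms by (auto simp: Fix_pts_def mspace_full_shift shift_space_def)
  ultimately have "card ?F \<le> card {l. set l \<subseteq> {1..d} \<and> length l = n}"
    by (intro card_inj_on_le) (auto intro: finite_lists_length_eq)
  then show ?thesis by (simp add: card_lists_length_eq)
qed

locale lipschitz_potential =
  fixes d :: nat and \<theta> :: real and f :: "(nat \<Rightarrow> nat) \<Rightarrow> real" and L :: real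
  assumes d: "1 \<le> d" and th0: "0 < \<theta>" and th1: "\<theta> < 1" and L: "0 \<le> L"
    and lip: "x \<in> shift_space d \<Longrightarrow> y \<in> shift_space d \<Longrightarrow> \<bar>f x - f y\<bar> \<le> L * shift_dist \<theta> x y"
    and pos: "x \<in> shift_space d \<Longrightarrow> 0 < f x"
begin

abbreviation "S \<equiv> birkhoff_sum shift_map f"
abbreviation "Per \<equiv> Fix_pts (full_shift d \<theta>) shift_map"

text \<open>The geometric series with terms \<open>L * \<theta> ^ i\<close>: it bounds the total
  error of a Birkhoff sum when an orbit segment is replaced by its periodic closure.\<close>

definition "C = L / (1 - \<theta>)"

definition "beta = (SUP (n, y)\<in>(SIGMA n:{1..}. Per n). S n y / real n)"

lemma C_nonneg: "0 \<le> C" using L th1 by (simp add: C_def)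

lemma Per_iff: "y \<in> Per n \<longleftrightarrow> y \<in> shift_space d \<and> (shift_map ^^ n) y = y"
  by (simp add: Fix_pts_def mspace_full_shift th0 th1)

text \<open>Repeat the first \<open>p\<close> symbols periodically. Because \<open>x\<close> repeats
  its initial word of length \<open>m\<close> after \<open>p\<close> steps, the two sequences agree
  on \<open>p + m\<close> symbols, which gains the factor \<open>\<theta> ^ m\<close> over the plain
  closing cost.\<close>

lemma closing:
  assumes x: "x \<in> shift_space d" and p: "1 \<le> p" and rec: "\<And>k. k < m \<Longrightarrow> x (p + k) = x k"
  obtains z where "z \<in> Per p" "\<bar>S p z - S p x\<bar> \<le> C * \<theta> ^ m"
proof (rule that)
  let ?z = "\<lambda>i. x (i mod p)"
  show z: "?z \<in> Per p"
    using x by (simp add: Per_iff shift_space_def shift_map_funpow)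
  \<comment> \<open>Strong induction: an index \<open>i \<ge> p\<close> is carried back to
    \<open>i - p\<close>, which lies below \<open>m\<close>, so the recurrence assumption applies
    there.\<close>
  have agree: "?z i = x i" if "i < p + m" for i
    using that
  proof (induction i rule: less_induct)
    case (less i)
    show ?case
    proof (cases "i < p")
      case False
      then have "?z i = ?z (i - p)" by (simp add: le_mod_geq)
      also have "\<dots> = x (i - p)" using less p False by simp
      also have "\<dots> = x i" using rec[of "i - p"] less.prems False by simp
      finally show ?thesis .
    qed simp
  qed
  \<comment> \<open>At time \<open>i\<close> the points still agree on \<open>p + m - i\<close>
    symbols; one less is used, so that the exponents \<open>p - Suc i\<close> run through
    \<open>0\<close> to \<open>p - 1\<close>.\<close>
  have "\<bar>f ((shift_map ^^ i) ?z) - f ((shift_map ^^ i) x)\<bar> \<le> L * \<theta> ^ m * \<theta> ^ (p - Suc i)"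
    if i: "i < p" for i
  proof -
    have "\<bar>f ((shift_map ^^ i) ?z) - f ((shift_map ^^ i) x)\<bar>
        \<le> L * shift_dist \<theta> ((shift_map ^^ i) ?z) ((shift_map ^^ i) x)"
      using z x by (intro lip shift_space_funpow) (auto simp: Per_iff)
    also have "\<dots> \<le> L * \<theta> ^ (m + (p - Suc i))"
      using i by (intro mult_left_mono L shift_dist_le_power th0 th1)
        (simp add: shift_map_funpow agree)
    finally show ?thesis by (simp add: power_add mult.assoc)
  qed
  then have "\<bar>S p ?z - S p x\<bar> \<le> (\<Sum>i<p. L * \<theta> ^ m * \<theta> ^ (p - Suc i))"
    unfolding birkhoff_sum_def sum_subtractf[symmetric]
    by (intro order_trans[OF sum_abs] sum_mono) auto
  also have "\<dots> = L * \<theta> ^ m * (\<Sum>i<p. \<theta> ^ i)"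
    by (simp add: sum.nat_diff_reindex flip: sum_distrib_left)
  also have "\<dots> = L * \<theta> ^ m * ((1 - \<theta> ^ p) / (1 - \<theta>))"
    using th1 by (simp add: sum_gp_strict)
  also have "\<dots> \<le> L * \<theta> ^ m * (1 / (1 - \<theta>))"
    using th0 th1 L by (intro mult_left_mono divide_right_mono) auto
  finally show "\<bar>S p ?z - S p x\<bar> \<le> C * \<theta> ^ m" by (simp add: C_def)
qed

lemma closing_0:
  assumes "x \<in> shift_space d" "1 \<le> p"
  obtains z where "z \<in> Per p" "\<bar>S p z - S p x\<bar> \<le> C"
  using closing[OF assms, of 0] by auto

lemma ones: "(\<lambda>_. 1) \<in> shift_space d" using d by (simp add: shift_space_def)

lemma ones_Per: "(\<lambda>_. 1) \<in> Per n"
  using ones by (simp add: Per_iff shift_map_funpow)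

lemma f_le: "x \<in> shift_space d \<Longrightarrow> f x \<le> f (\<lambda>_. 1) + L"
proof -
  assume x: "x \<in> shift_space d"
  have "L * shift_dist \<theta> x (\<lambda>_. 1) \<le> L * \<theta> ^ 0"
    by (intro mult_left_mono L shift_dist_le_power th0 th1) auto
  then show ?thesis using lip[OF x ones] by simp
qed

lemma bdd_above_Per_means: "bdd_above ((\<lambda>(n, y). S n y / real n) ` (SIGMA n:{1..}. Per n))"
proof (rule bdd_aboveI2[where M="f (\<lambda>_. 1) + L"])
  fix a assume "a \<in> (SIGMA n:{1..}. Per n)"
  then obtain n y where a: "a = (n, y)" and n: "1 \<le> n" and y: "y \<in> Per n" by auto
  have "S n y \<le> (\<Sum>i<n. f (\<lambda>_. 1) + L)"
    unfolding birkhoff_sum_def using y by (intro sum_mono f_le shift_space_funpow) (simp add: Per_iff)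
  then show "(\<lambda>(n, y). S n y / real n) a \<le> f (\<lambda>_. 1) + L"
    using n by (simp add: a field_simps)
qed

lemma S_Per_le:
  assumes "1 \<le> n" "y \<in> Per n"
  shows "S n y \<le> real n * beta"
proof -
  have "(\<lambda>(n, y). S n y / real n) (n, y) \<le> beta"
    unfolding beta_def by (intro cSUP_upper bdd_above_Per_means) (use assms in auto)
  then show ?thesis using assms by (simp add: field_simps)
qed

lemma beta_pos: "0 < beta"
  using S_Per_le[OF _ ones_Per, of 1] pos[OF ones] by (simp add: birkhoff_sum_def)

lemma S_le:
  assumes "x \<in> shift_space d"
  shows "S n x \<le> real n * beta + C"
proof (cases "n = 0")
  case True
  then show ?thesis by (simp add: birkhoff_sum_def C_nonneg)
next
  case False
  then obtain z where "z \<in> Per n" "\<bar>S n z - S n x\<bar> \<le> C"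
    using closing_0[OF assms, of n] by auto
  then show ?thesis using S_Per_le[of n z] False by simp
qed

text \<open>Take a periodic orbit with mean within \<open>1 / n\<close> of \<open>beta\<close>. The
  average of the sums of length \<open>n\<close> over its starting points is \<open>n\<close> times
  that mean, hence above \<open>n * beta - 1\<close>, and some starting point does at least as well
  as the average.\<close>

lemma S_ge: "\<exists>x\<in>shift_space d. S n x \<ge> real n * beta - 1"
proof (cases "n = 0")
  case True
  then show ?thesis using ones by (auto simp: birkhoff_sum_def)
next
  case False
  have "beta - 1 / real n < beta" using False by simp
  moreover have "(SIGMA n:{1..}. Per n) \<noteq> {}" using ones_Per by auto
  ultimately obtain a where a: "a \<in> (SIGMA n:{1..}. Per n)"
      and "beta - 1 / real n < (case a of (n, y) \<Rightarrow> S n y / real n)"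
    using less_cSUP_iff[OF _ bdd_above_Per_means, folded beta_def] by blast
  then obtain m y where m: "1 \<le> m" and y: "y \<in> Per m"
      and my: "beta - 1 / real n < S m y / real m"
    by (cases a) auto
  show ?thesis
  proof (rule ccontr)
    assume "\<not> ?thesis"
    then have "S n ((shift_map ^^ i) y) < real n * beta - 1" for i
      using y shift_space_funpow[of y d i] by (auto simp: Per_iff not_le)
    then have "(\<Sum>i<m. S n ((shift_map ^^ i) y)) \<le> (\<Sum>i<m. real n * beta - 1)"
      by (intro sum_mono) (simp add: less_imp_le)
    then have "real n * S m y \<le> real m * (real n * beta - 1)"
      using y by (simp add: sum_birkhoff_sum_orbit Per_iff)
    moreover have "real m * (real n * beta - 1) < real n * S m y"
      using my m False by (simp add: field_simps)
    ultimately show False by simp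
  qed
qed

lemma S_Per_ge:
  assumes "1 \<le> n"
  shows "\<exists>y\<in>Per n. S n y \<ge> real n * beta - 1 - C"
proof -
  obtain x where x: "x \<in> shift_space d" "S n x \<ge> real n * beta - 1" using S_ge by blast
  obtain z where "z \<in> Per n" "\<bar>S n z - S n x\<bar> \<le> C" using closing_0[OF x(1) assms] by blast
  then show ?thesis using x by force
qed

text \<open>Along an almost maximizing orbit segment the deficits \<open>S i x - i * beta\<close> stay bounded, so
  by the pigeonhole principle two times \<open>i < j\<close> have nearly equal deficits and the same
  word of length \<open>m\<close>; closing up the segment between them gives the periodic point.\<close>

lemma recurrence:
  assumes "\<epsilon> > 0"
  obtains n y where "1 \<le> n" "y \<in> Per n" "S n y \<ge> real n * beta - \<epsilon>"
proof -
  \<comment> \<open>The length \<open>m\<close> is chosen so that closing after a repeated word of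
    length \<open>m\<close> costs less than half of \<open>\<epsilon>\<close>; \<open>C + 1\<close>
    replaces \<open>C\<close>, which may be 0.\<close>
  have "0 < \<epsilon> / (2 * (C + 1))" using assms C_nonneg by simp
  then obtain m where m: "\<theta> ^ m < \<epsilon> / (2 * (C + 1))" using real_arch_pow_inv[OF _ th1] by blast
  then have "(C + 1) * \<theta> ^ m < \<epsilon> / 2" using C_nonneg by (simp add: field_simps)
  then have m: "C * \<theta> ^ m < \<epsilon> / 2" using th0 by (simp add: algebra_simps) (smt (verit) zero_less_power)
  define R where "R = \<lceil>(C + 1) * 2 / \<epsilon>\<rceil>"
  define W where "W = {l. set l \<subseteq> {1..d} \<and> length l = m} \<times> {-R..R}"
  have finW: "finite W" unfolding W_def by (intro finite_cartesian_product finite_lists_length_eq) auto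
  \<comment> \<open>The times \<open>0\<close> to \<open>n\<close> are one more than the boxes in
    \<open>W\<close>, so two of them share a box.\<close>
  define n where "n = card W"
  obtain x where x: "x \<in> shift_space d" "S n x \<ge> real n * beta - 1" using S_ge by blast
  define D where "D i = S i x - real i * beta" for i
  define F where "F i = (map (\<lambda>k. x (i + k)) [0..<m], \<lfloor>D i * 2 / \<epsilon>\<rfloor>)" for i
  \<comment> \<open>The lower bound holds because the whole segment loses at most 1 against
    \<open>n * beta\<close> and its remainder gains at most \<open>C\<close>.\<close>
  have D: "\<bar>D i\<bar> \<le> C + 1" if "i \<le> n" for i
  proof -
    have "S n x = S i x + S (n - i) ((shift_map ^^ i) x)"
      using birkhoff_sum_add[of shift_map f i "n - i" x] that by simp
    moreover have "S (n - i) ((shift_map ^^ i) x) \<le> real (n - i) * beta + C"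
      by (intro S_le shift_space_funpow x)
    ultimately have "D i \<ge> - C - 1"
      using x that by (simp add: D_def of_nat_diff algebra_simps)
    then show ?thesis using S_le[OF x(1), of i] by (simp add: D_def)
  qed
  have "F ` {0..n} \<subseteq> W"
  proof
    fix w assume "w \<in> F ` {0..n}"
    then obtain i where i: "i \<le> n" "w = F i" by auto
    have "\<bar>D i * 2 / \<epsilon>\<bar> \<le> (C + 1) * 2 / \<epsilon>"
      using D[OF i(1)] assms by (simp add: abs_mult divide_right_mono)
    then have "- R \<le> \<lfloor>D i * 2 / \<epsilon>\<rfloor>" "\<lfloor>D i * 2 / \<epsilon>\<rfloor> \<le> R"
      unfolding R_def by linarith+
    then show "w \<in> W" using x i by (auto simp: F_def W_def shift_space_def)
  qed
  then have "\<not> inj_on F {0..n}"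
    using card_inj_on_le[OF _ _ finW, of F "{0..n}"] by (auto simp: n_def)
  then obtain i j where ij: "i < j" "j \<le> n" "F i = F j"
    by (auto simp: inj_on_def) (metis linorder_neqE_nat)
  define p where "p = j - i"
  have p: "1 \<le> p" "j = i + p" using ij by (auto simp: p_def)
  have word: "x (i + k) = x (j + k)" if "k < m" for k
    using ij(3) that by (auto simp: F_def)
  have "\<lfloor>D i * 2 / \<epsilon>\<rfloor> = \<lfloor>D j * 2 / \<epsilon>\<rfloor>" using ij(3) by (simp add: F_def)
  \<comment> \<open>Arguments with equal floors differ by less than 1, that is, the deficits by less
    than half of \<open>\<epsilon>\<close>; the closing error spends the other half.\<close>
  then have "D i * 2 / \<epsilon> - D j * 2 / \<epsilon> < 1" by linarith
  then have DD: "D i - D j < \<epsilon> / 2" using assms by (simp add: field_simps)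
  have "S j x = S i x + S p ((shift_map ^^ i) x)" using p by (simp add: birkhoff_sum_add)
  then have "S p ((shift_map ^^ i) x) > real p * beta - \<epsilon> / 2"
    using DD p by (simp add: D_def algebra_simps)
  moreover have "(shift_map ^^ i) x (p + k) = (shift_map ^^ i) x k" if "k < m" for k
    using word[OF that] p by (simp add: shift_map_funpow algebra_simps)
  then obtain z where "z \<in> Per p" "\<bar>S p z - S p ((shift_map ^^ i) x)\<bar> \<le> C * \<theta> ^ m"
    using closing[OF shift_space_funpow[OF x(1)] p(1)] by blast
  ultimately show ?thesis using that[OF p(1), of z] m by linarith
qed

lemma continuous_f: "continuous_fun (full_shift d \<theta>) f"
proof -
  have "Lipschitz_continuous_map (full_shift d \<theta>) euclidean_metric f"
    unfolding Lipschitz_continuous_map_def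
    using lip by (auto simp: mspace_full_shift mdist_full_shift th0 th1 dist_real_def)
  then show ?thesis
    using Lipschitz_continuous_imp_continuous_map by (force simp: continuous_fun_def)
qed

text \<open>By invariance the Birkhoff sum of length \<open>n\<close> integrates to \<open>n\<close>
  times the integral of \<open>f\<close>, and \<open>S_le\<close> bounds it by
  \<open>n * beta + C\<close>; for large \<open>n\<close> the constant is negligible.\<close>

lemma integral_invariant_le:
  assumes \<nu>: "\<nu> \<in> invariant_probs (full_shift d \<theta>) shift_map"
  shows "integral\<^sup>L \<nu> f \<le> beta"
proof -
  have b: "\<nu> \<in> borel_probs (full_shift d \<theta>)" using \<nu> by (simp add: invariant_probs_def)
  have T: "shift_map \<in> measurable \<nu> \<nu>" using \<nu> by (simp add: invariant_probs_def)
  interpret prob_space \<nu> using b by (simp add: borel_probs_def)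
  have inv: "distr \<nu> \<nu> shift_map = \<nu>"
    using \<nu> by (intro measure_eqI) (auto simp: emeasure_distr invariant_probs_def)
  have mf: "f \<in> borel_measurable \<nu>" by (rule continuous_fun_borel_measurable[OF continuous_f b])
  have If: "integrable \<nu> f" by (rule continuous_fun_integrable[OF th0 th1 continuous_f b])
  have Ti: "shift_map ^^ i \<in> measurable \<nu> \<nu>" for i by (rule measurable_compose_n[OF T])
  have inv_i: "distr \<nu> \<nu> (shift_map ^^ i) = \<nu>" for i
  proof (induction i)
    case (Suc i)
    have "distr \<nu> \<nu> (shift_map ^^ Suc i) = distr (distr \<nu> \<nu> (shift_map ^^ i)) \<nu> shift_map"
      using distr_distr[OF T Ti[of i]] by simp
    then show ?case by (simp only: Suc inv)
  qed (simp add: distr_id2)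
  have Ii: "integrable \<nu> (\<lambda>x. f ((shift_map ^^ i) x))"
    "integral\<^sup>L \<nu> (\<lambda>x. f ((shift_map ^^ i) x)) = integral\<^sup>L \<nu> f" for i
    using integrable_distr_eq[OF Ti mf] integral_distr[OF Ti mf] If by (simp_all add: inv_i)
  have *: "real n * integral\<^sup>L \<nu> f \<le> real n * beta + C" for n
  proof -
    have "real n * integral\<^sup>L \<nu> f = integral\<^sup>L \<nu> (S n)"
      unfolding birkhoff_sum_def using Ii by simp
    also have "\<dots> \<le> real n * beta + C"
    proof (rule integral_le_const)
      show "integrable \<nu> (S n)" unfolding birkhoff_sum_def using Ii by simp
      show "AE x in \<nu>. S n x \<le> real n * beta + C"
        using S_le borel_probs_sets_space(2)[OF b] by (auto simp: mspace_full_shift th0 th1)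
    qed
    finally show ?thesis .
  qed
  show ?thesis
  proof (rule ccontr)
    assume "\<not> ?thesis"
    then obtain n where "C < real n * (integral\<^sup>L \<nu> f - beta)"
      using reals_Archimedean3[of "integral\<^sup>L \<nu> f - beta"] by auto
    then show False using *[of n] by (simp add: algebra_simps)
  qed
qed

end

subsection \<open>Bounds for the pressure\<close>

text \<open>By monotonicity the values increase to their supremum as the argument decreases to
  \<open>a\<close>; this turns the limit in the definition of pressure into a supremum that can be
  bounded termwise.\<close>

lemma tendsto_at_right_antimono_ereal:
  fixes F :: "real \<Rightarrow> ereal"
  assumes anti: "\<And>x y. a < x \<Longrightarrow> x \<le> y \<Longrightarrow> F y \<le> F x"
  shows "(F \<longlongrightarrow> (SUP x\<in>{a<..}. F x)) (at_right a)"
proof (rule order_tendstoI)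
  fix u assume "u < (SUP x\<in>{a<..}. F x)"
  then obtain x where x: "x > a" "u < F x" by (auto simp: less_SUP_iff)
  then have "u < F y" if "a < y" "y < x" for y
    using anti[of y x] that by (auto intro: less_le_trans)
  then show "\<forall>\<^sub>F y in at_right a. u < F y"
    using x(1) unfolding eventually_at_right_field by blast
next
  fix u assume u: "(SUP x\<in>{a<..}. F x) < u"
  have "F y < u" if "a < y" for y
    using that by (intro le_less_trans[OF SUP_upper u]) auto
  then show "\<forall>\<^sub>F y in at_right a. F y < u"
    unfolding eventually_at_right_field by (intro exI[of _ "a + 1"]) auto
qed

context lipschitz_potential
begin

lemma birkhoff_sum_scaled: "birkhoff_sum shift_map (\<lambda>y. c * f y) n x = c * S n x"
  by (simp add: birkhoff_sum_def sum_distrib_left)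

abbreviation "Sep \<equiv> separated_sets (full_shift d \<theta>) shift_map"

definition separated_sup :: "real \<Rightarrow> nat \<Rightarrow> real \<Rightarrow> real" where
  "separated_sup c n \<epsilon> = (SUP E\<in>Sep n \<epsilon>. \<Sum>x\<in>E. exp (c * S n x))"

lemma singleton_separated: "x \<in> shift_space d \<Longrightarrow> {x} \<in> Sep n \<epsilon>"
  by (simp add: separated_sets_def mspace_full_shift th0 th1)

text \<open>Points with the same first \<open>n + k\<close> symbols stay within
  \<open>\<theta> ^ k\<close> of each other at every time below \<open>n\<close>, so separated
  points carry different words of that length.\<close>

lemma separated_card_le:
  assumes E: "E \<in> Sep n \<epsilon>" and k: "\<theta> ^ k \<le> \<epsilon>"
  shows "card E \<le> d ^ (n + k)"
proof -
  have sub: "E \<subseteq> shift_space d" using E by (simp add: separated_sets_def mspace_full_shift th0 th1)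
  have "inj_on (\<lambda>x. map x [0..<n + k]) E"
  proof (rule inj_onI, rule ccontr)
    fix x y assume xy: "x \<in> E" "y \<in> E" "x \<noteq> y" and "map x [0..<n + k] = map y [0..<n + k]"
    then have eq: "x i = y i" if "i < n + k" for i using that by (simp add: map_eq_conv)
    obtain i where i: "i < n" "shift_dist \<theta> ((shift_map ^^ i) x) ((shift_map ^^ i) y) > \<epsilon>"
      using E xy unfolding separated_sets_def mdist_full_shift[OF th0 th1] by blast
    have "shift_dist \<theta> ((shift_map ^^ i) x) ((shift_map ^^ i) y) \<le> \<theta> ^ k"
      using i(1) by (intro shift_dist_le_power th0 th1) (simp add: shift_map_funpow eq)
    then show False using i k by simp
  qed
  moreover have "(\<lambda>x. map x [0..<n + k]) ` E \<subseteq> {l. set l \<subseteq> {1..d} \<and> length l = n + k}"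
    using sub by (auto simp: shift_space_def subset_iff)
  ultimately have "card E \<le> card {l. set l \<subseteq> {1..d} \<and> length l = n + k}"
    by (intro card_inj_on_le) (auto intro: finite_lists_length_eq)
  then show ?thesis by (simp add: card_lists_length_eq)
qed

lemma separated_sum_le:
  assumes E: "E \<in> Sep n \<epsilon>" and k: "\<theta> ^ k \<le> \<epsilon>" and c: "0 \<le> c"
  shows "(\<Sum>x\<in>E. exp (c * S n x)) \<le> real d ^ (n + k) * exp (c * (real n * beta + C))"
proof -
  have "(\<Sum>x\<in>E. exp (c * S n x)) \<le> real (card E) * exp (c * (real n * beta + C))"
    using E c
    by (intro sum_bounded_above)
       (auto simp: separated_sets_def mspace_full_shift th0 th1 intro!: mult_left_mono S_le)
  also have "real (card E) \<le> real d ^ (n + k)"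
    using separated_card_le[OF E k] by (metis of_nat_le_iff of_nat_power)
  finally show ?thesis by simp
qed

lemma separated_bdd:
  assumes "0 < \<epsilon>" "0 \<le> c"
  shows "bdd_above ((\<lambda>E. \<Sum>x\<in>E. exp (c * S n x)) ` Sep n \<epsilon>)"
proof -
  obtain k where "\<theta> ^ k < \<epsilon>" using real_arch_pow_inv[OF assms(1) th1] by blast
  then show ?thesis
    using separated_sum_le[of _ n \<epsilon> k c] assms by (intro bdd_aboveI2) auto
qed

lemma separated_sup_ge:
  assumes "0 < \<epsilon>" "0 \<le> c"
  shows "exp (c * (real n * beta - 1)) \<le> separated_sup c n \<epsilon>"
proof -
  obtain x where x: "x \<in> shift_space d" "S n x \<ge> real n * beta - 1" using S_ge by blast
  then have "exp (c * (real n * beta - 1)) \<le> (\<Sum>x\<in>{x}. exp (c * S n x))"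
    using assms by (simp add: mult_left_mono)
  also have "\<dots> \<le> separated_sup c n \<epsilon>"
    unfolding separated_sup_def
    by (intro cSUP_upper singleton_separated x separated_bdd assms)
  finally show ?thesis .
qed

lemma separated_sup_le:
  assumes "\<theta> ^ k \<le> \<epsilon>" "0 \<le> c"
  shows "separated_sup c n \<epsilon> \<le> real d ^ (n + k) * exp (c * (real n * beta + C))"
  unfolding separated_sup_def
  using singleton_separated[OF ones] by (intro cSUP_least separated_sum_le[OF _ assms]) auto

lemma separated_sup_antimono:
  assumes "0 < \<epsilon>" "\<epsilon> \<le> \<epsilon>'" "0 \<le> c"
  shows "separated_sup c n \<epsilon>' \<le> separated_sup c n \<epsilon>"
  unfolding separated_sup_def
proof (rule cSUP_subset_mono)
  show "Sep n \<epsilon>' \<subseteq> Sep n \<epsilon>"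
    using assms by (fastforce simp: separated_sets_def)
  show "Sep n \<epsilon>' \<noteq> {}" using singleton_separated[OF ones] by blast
  show "bdd_above ((\<lambda>E. \<Sum>x\<in>E. exp (c * S n x)) ` Sep n \<epsilon>)"
    using assms by (intro separated_bdd) auto
qed simp

definition pressure_at :: "real \<Rightarrow> real \<Rightarrow> ereal" where
  "pressure_at c \<epsilon> = limsup (\<lambda>n. ereal (ln (separated_sup c n \<epsilon>) / real n))"

lemma pressure_at_antimono:
  assumes "0 < \<epsilon>" "\<epsilon> \<le> \<epsilon>'" "0 \<le> c"
  shows "pressure_at c \<epsilon>' \<le> pressure_at c \<epsilon>"
  unfolding pressure_at_def
proof (intro Limsup_mono always_eventually allI)
  fix n
  have "0 < separated_sup c n \<epsilon>'"
    using assms by (intro less_le_trans[OF exp_gt_zero separated_sup_ge]) auto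
  then show "ereal (ln (separated_sup c n \<epsilon>') / real n) \<le> ereal (ln (separated_sup c n \<epsilon>) / real n)"
    using separated_sup_antimono[OF assms, of n] by (simp add: divide_right_mono)
qed

lemma pressure_at_ge:
  assumes "0 < \<epsilon>" "0 \<le> c"
  shows "ereal (c * beta) \<le> pressure_at c \<epsilon>"
proof -
  have "(\<lambda>n. c * beta - c / real n) \<longlonglongrightarrow> c * beta - 0"
    by (intro tendsto_intros lim_const_over_n)
  then have "(\<lambda>n. ereal (c * beta - c / real n)) \<longlonglongrightarrow> ereal (c * beta)" by simp
  then have "ereal (c * beta) = limsup (\<lambda>n. ereal (c * beta - c / real n))"
    by (rule lim_imp_Limsup[OF trivial_limit_sequentially, symmetric])
  also have "\<dots> \<le> pressure_at c \<epsilon>"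
    unfolding pressure_at_def
  proof (rule Limsup_mono)
    show "\<forall>\<^sub>F n in sequentially. ereal (c * beta - c / real n) \<le> ereal (ln (separated_sup c n \<epsilon>) / real n)"
      \<comment> \<open>At \<open>n = 0\<close> division yields 0 and the comparison can fail, so
        that index is left out.\<close>
      using eventually_gt_at_top[of 0]
    proof eventually_elim
      case (elim n)
      have "ln (exp (c * (real n * beta - 1))) \<le> ln (separated_sup c n \<epsilon>)"
        using separated_sup_ge[OF assms] by (subst ln_le_cancel_iff) (auto intro: less_le_trans[OF exp_gt_zero])
      then have "c * (real n * beta - 1) / real n \<le> ln (separated_sup c n \<epsilon>) / real n"
        by (simp add: divide_right_mono)
      then show ?case using elim by (simp add: field_simps)
    qed
  qed
  finally show ?thesis .
qed

lemma pressure_at_le: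
  assumes "0 < \<epsilon>" "0 \<le> c"
  shows "pressure_at c \<epsilon> \<le> ereal (c * beta + ln (real d))"
proof -
  obtain k where k: "\<theta> ^ k < \<epsilon>" using real_arch_pow_inv[OF assms(1) th1] by blast
  \<comment> \<open>The \<open>k\<close> extra symbols of the words and the constant
    \<open>C\<close> contribute only a term of order \<open>1 / n\<close>.\<close>
  let ?u = "\<lambda>n. c * beta + ln (real d) + (real k * ln (real d) + c * C) / real n"
  have "?u \<longlonglongrightarrow> c * beta + ln (real d) + 0"
    by (intro tendsto_intros lim_const_over_n)
  then have "(\<lambda>n. ereal (?u n)) \<longlonglongrightarrow> ereal (c * beta + ln (real d))" by simp
  then have "ereal (c * beta + ln (real d)) = limsup (\<lambda>n. ereal (?u n))"
    by (rule lim_imp_Limsup[OF trivial_limit_sequentially, symmetric])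
  moreover have "pressure_at c \<epsilon> \<le> limsup (\<lambda>n. ereal (?u n))"
    unfolding pressure_at_def
  proof (rule Limsup_mono)
    show "\<forall>\<^sub>F n in sequentially. ereal (ln (separated_sup c n \<epsilon>) / real n) \<le> ereal (?u n)"
      using eventually_gt_at_top[of 0]
    proof eventually_elim
      case (elim n)
      have "0 < separated_sup c n \<epsilon>"
        using assms by (intro less_le_trans[OF exp_gt_zero separated_sup_ge]) auto
      then have "ln (separated_sup c n \<epsilon>) \<le> ln (real d ^ (n + k) * exp (c * (real n * beta + C)))"
        using separated_sup_le[of k \<epsilon> c n] k assms d by (subst ln_le_cancel_iff) auto
      also have "\<dots> = real (n + k) * ln (real d) + c * (real n * beta + C)"
        using d by (simp add: ln_mult ln_realpow)
      finally have "ln (separated_sup c n \<epsilon>) / real n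
          \<le> (real (n + k) * ln (real d) + c * (real n * beta + C)) / real n"
        by (simp add: divide_right_mono)
      also have "\<dots> = ?u n" using elim by (simp add: field_simps)
      finally show ?case by simp
    qed
  qed
  ultimately show ?thesis by simp
qed

abbreviation "P c \<equiv> topological_pressure (full_shift d \<theta>) shift_map (\<lambda>y. c * f y)"

lemma pressure_bounds:
  assumes "0 \<le> c"
  shows "c * beta \<le> P c" "P c \<le> c * beta + ln (real d)"
proof -
  define l where "l = (SUP \<epsilon>\<in>{0<..}. pressure_at c \<epsilon>)"
  have "(pressure_at c \<longlongrightarrow> l) (at_right 0)"
    unfolding l_def using assms by (intro tendsto_at_right_antimono_ereal pressure_at_antimono)
  then have "Lim (at_right 0) (pressure_at c) = l"
    by (intro tendsto_Lim) auto
  then have P: "P c = real_of_ereal l"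
    by (simp add: topological_pressure_def pressure_at_def[abs_def] separated_sup_def birkhoff_sum_scaled)
  \<comment> \<open>Bounds from both sides make \<open>l\<close> finite, so
    \<open>real_of_ereal\<close> returns its value and not the default for infinity.\<close>
  have "ereal (c * beta) \<le> l"
    unfolding l_def using pressure_at_ge[of 1 c] assms by (intro SUP_upper2[of 1]) auto
  moreover have "l \<le> ereal (c * beta + ln (real d))"
    unfolding l_def using pressure_at_le assms by (intro SUP_least) auto
  ultimately show "c * beta \<le> P c" "P c \<le> c * beta + ln (real d)"
    unfolding P by (cases l; simp)+
qed

end

subsection \<open>Concentration near the maximal mean\<close>

context lipschitz_potential
begin

lemma finite_Per: "1 \<le> n \<Longrightarrow> finite (Per n)"
  by (rule finite_Fix_shift[OF th0 th1])

lemma S_nonneg: "x \<in> shift_space d \<Longrightarrow> 0 \<le> S n x"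
  unfolding birkhoff_sum_def by (intro sum_nonneg less_imp_le pos shift_space_funpow)

definition bad_weight :: "(nat \<Rightarrow> (nat \<Rightarrow> nat) \<Rightarrow> real) \<Rightarrow> real \<Rightarrow> nat \<Rightarrow> real" where
  "bad_weight w \<delta> N =
     (\<Sum>n=1..N. \<Sum>x\<in>Per n. if S n x < real n * (beta - \<delta>) then w n x else 0)"

text \<open>Terms outside the bad set have mean at least \<open>beta - \<delta>\<close>; bad ones
  are at least 0 as \<open>f\<close> is positive, so each loses at most \<open>beta\<close>. With a
  bad share of at most \<open>\<delta>\<close> the total loss is at most
  \<open>\<delta> + beta * \<delta>\<close>.\<close>

lemma weighted_mean_ge:
  assumes w: "\<And>n x. 0 < w n x" and N: "1 \<le> N" and \<delta>: "0 \<le> \<delta>"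
    and bad: "bad_weight w \<delta> N \<le> \<delta> * (\<Sum>n=1..N. \<Sum>x\<in>Per n. w n x)"
  shows "(\<Sum>n=1..N. \<Sum>x\<in>Per n. w n x * (S n x / real n)) / (\<Sum>n=1..N. \<Sum>x\<in>Per n. w n x)
    \<ge> beta - (1 + beta) * \<delta>"
proof -
  let ?Z = "\<Sum>n=1..N. \<Sum>x\<in>Per n. w n x"
  have Z: "0 < ?Z" using total_weight_pos[OF th0 th1 d N w] by (simp add: total_weight_def)
  have "w n x * (S n x / real n)
      \<ge> (beta - \<delta>) * w n x - beta * (if S n x < real n * (beta - \<delta>) then w n x else 0)"
    if n: "n \<in> {1..N}" and x: "x \<in> Per n" for n x
  proof (cases "S n x < real n * (beta - \<delta>)")
    case True
    have "0 \<le> S n x" using x by (intro S_nonneg) (simp add: Per_iff)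
    then have "0 \<le> w n x * (S n x / real n)" using w[of n x] by simp
    moreover have "0 \<le> \<delta> * w n x" using w[of n x] \<delta> by simp
    ultimately show ?thesis using True by (simp add: algebra_simps)
  next
    case False
    then have "beta - \<delta> \<le> S n x / real n" using n by (simp add: field_simps)
    then have "(beta - \<delta>) * w n x \<le> (S n x / real n) * w n x"
      using w[of n x] by (intro mult_right_mono) auto
    then show ?thesis using False by (simp add: mult.commute)
  qed
  then have "(\<Sum>n=1..N. \<Sum>x\<in>Per n. w n x * (S n x / real n)) \<ge>
     (\<Sum>n=1..N. \<Sum>x\<in>Per n. (beta - \<delta>) * w n x - beta * (if S n x < real n * (beta - \<delta>) then w n x else 0))"
    by (intro sum_mono) auto
  also have "(\<Sum>n=1..N. \<Sum>x\<in>Per n. (beta - \<delta>) * w n x - beta * (if S n x < real n * (beta - \<delta>) then w n x else 0))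
     = (beta - \<delta>) * ?Z - beta * bad_weight w \<delta> N"
    by (simp add: bad_weight_def sum_subtractf sum_distrib_left)
  also have "\<dots> \<ge> (beta - \<delta>) * ?Z - beta * (\<delta> * ?Z)"
    using bad beta_pos by (intro diff_left_mono mult_left_mono) auto
  finally have "(beta - (1 + beta) * \<delta>) * ?Z \<le> (\<Sum>n=1..N. \<Sum>x\<in>Per n. w n x * (S n x / real n))"
    by (simp add: algebra_simps)
  then show ?thesis using Z by (simp add: pos_le_divide_eq)
qed

lemma total_weight_ge:
  fixes w :: "nat \<Rightarrow> (nat \<Rightarrow> nat) \<Rightarrow> real"
  assumes "\<And>n x. 0 \<le> w n x" "1 \<le> n" "n \<le> N" "y \<in> Per n"
  shows "w n y \<le> (\<Sum>n=1..N. \<Sum>x\<in>Per n. w n x)"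
proof -
  have "w n y \<le> (\<Sum>x\<in>Per n. w n x)"
    using assms finite_Per by (intro member_le_sum[of y "Per n" "w n"]) auto
  also have "\<dots> \<le> (\<Sum>n=1..N. \<Sum>x\<in>Per n. w n x)"
    using assms by (intro member_le_sum[of n "{1..N}" "\<lambda>n. \<Sum>x\<in>Per n. w n x"] sum_nonneg) auto
  finally show ?thesis .
qed

lemma bad_weight_le:
  assumes b: "\<And>n x. 1 \<le> n \<Longrightarrow> n \<le> N \<Longrightarrow> S n x < real n * (beta - \<delta>) \<Longrightarrow> w n x \<le> b n"
    and b0: "\<And>n. 0 \<le> b n"
  shows "bad_weight w \<delta> N \<le> (\<Sum>n=1..N. real d ^ n * b n)"
  unfolding bad_weight_def
proof (rule sum_mono)
  fix n assume n: "n \<in> {1..N}"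
  have "(\<Sum>x\<in>Per n. if S n x < real n * (beta - \<delta>) then w n x else 0) \<le> real (card (Per n)) * b n"
    using n b b0 by (intro sum_bounded_above) auto
  also have "\<dots> \<le> real d ^ n * b n"
    using card_Fix_shift_le[OF th0 th1, of n d] n b0
    by (intro mult_right_mono) (auto simp flip: of_nat_power)
  finally show "(\<Sum>x\<in>Per n. if S n x < real n * (beta - \<delta>) then w n x else 0) \<le> real d ^ n * b n" .
qed

lemma eventually_exp_decay:
  assumes "0 < \<delta>" "0 < \<epsilon>"
  shows "\<forall>\<^sub>F c in at_top. K * exp (- (c * \<delta>)) \<le> (\<epsilon>::real)"
proof -
  have "((\<lambda>c. K * exp (- (c * \<delta>))) \<longlongrightarrow> 0) at_top"
    using assms by real_asymp
  then have "\<forall>\<^sub>F c in at_top. K * exp (- (c * \<delta>)) < \<epsilon>"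
    using assms(2) by (rule order_tendstoD)
  then show ?thesis by (rule eventually_mono) simp
qed

text \<open>For \<open>pi_measure\<close> short orbits matter as well, and the bad weight is only of order
  \<open>exp (- c * \<delta>)\<close>, so the denominator must be bounded below by a single periodic orbit whose
  total deficit, not just its mean deficit, is below \<open>\<delta> / 2\<close>.\<close>

lemma integral_pi_ge:
  assumes \<delta>: "0 < \<delta>"
  shows "\<exists>c0 N0. \<forall>c\<ge>c0. \<forall>N\<ge>N0. integral\<^sup>L (pi_measure d \<theta> f c N) f \<ge> beta - (1 + beta) * \<delta>"
proof -
  obtain m y where m: "1 \<le> m" "y \<in> Per m" "S m y \<ge> real m * beta - \<delta> / 2"
    using recurrence[of "\<delta> / 2"] \<delta> by auto
  have "\<forall>\<^sub>F c in at_top. 0 \<le> c \<and> real d * exp (- (c * \<delta>)) \<le> 1 / 2 \<and>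
      2 * real d ^ Suc m * exp (- (c * (\<delta> / 2))) \<le> \<delta>"
    using \<delta> by (intro eventually_conj eventually_exp_decay eventually_ge_at_top) auto
  \<comment> \<open>The second condition gives geometric decay of the bad weights in the period; the
    third, possible since \<open>m\<close> is already fixed, makes the bad weight at most
    \<open>\<delta>\<close> times the weight of \<open>y\<close>.\<close>
  then obtain c0 where c0: "\<And>c. c \<ge> c0 \<Longrightarrow> 0 \<le> c"
      "\<And>c. c \<ge> c0 \<Longrightarrow> real d * exp (- (c * \<delta>)) \<le> 1 / 2"
      "\<And>c. c \<ge> c0 \<Longrightarrow> 2 * real d ^ Suc m * exp (- (c * (\<delta> / 2))) \<le> \<delta>"
    by (auto simp: eventually_at_top_linorder)
  have "integral\<^sup>L (pi_measure d \<theta> f c N) f \<ge> beta - (1 + beta) * \<delta>"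
    if c: "c \<ge> c0" and N: "N \<ge> m" for c N
  proof -
    note P = pressure_bounds[OF c0(1)[OF c]]
    define w where "w n x = exp (c * S n x - real n * P c)" for n x
    define q where "q = exp (- (c * \<delta>))"
    have q: "0 < q" "real d * q \<le> 1 / 2" using c0(2)[OF c] by (auto simp: q_def)
    have "bad_weight w \<delta> N \<le> (\<Sum>n=1..N. real d ^ n * q ^ n)"
    proof (rule bad_weight_le)
      fix n x assume "S n x < real n * (beta - \<delta>)"
      then have "c * S n x \<le> c * (real n * (beta - \<delta>))"
        using c0(1)[OF c] by (intro mult_left_mono) auto
      moreover have "real n * (c * beta) \<le> real n * P c" using P by (intro mult_left_mono) auto
      ultimately have "c * S n x - real n * P c \<le> real n * (- (c * \<delta>))" by (simp add: algebra_simps)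
      then show "w n x \<le> q ^ n" unfolding w_def q_def exp_of_nat_mult[symmetric] by simp
    qed (use q in auto)
    also have "\<dots> = (\<Sum>n=1..N. (real d * q) ^ n)" by (simp add: power_mult_distrib)
    \<comment> \<open>One factor \<open>d * q\<close> is kept because it carries the decay in
      \<open>c\<close>; the powers of \<open>1 / 2\<close> left over sum to at most 2.\<close>
    also have "\<dots> \<le> (\<Sum>n=1..N. real d * q * (1 / 2) ^ (n - 1))"
    proof (rule sum_mono)
      fix n assume n: "n \<in> {1..N}"
      have "(real d * q) ^ (n - 1) \<le> (1 / 2) ^ (n - 1)" using q by (intro power_mono) auto
      then have "real d * q * (real d * q) ^ (n - 1) \<le> real d * q * (1 / 2) ^ (n - 1)"
        using q by (intro mult_left_mono) auto
      then show "(real d * q) ^ n \<le> real d * q * (1 / 2) ^ (n - 1)"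
        using n by (simp add: power_eq_if[of _ n])
    qed
    also have "\<dots> = real d * q * (\<Sum>n<N. (1 / 2) ^ n)"
      unfolding sum_distrib_left
      by (rule sum.reindex_bij_witness[of _ Suc "\<lambda>n. n - 1"]) auto
    also have "\<dots> \<le> real d * q * 2"
      using q by (intro mult_left_mono) (auto simp: sum_gp_strict)
    finally have bad: "bad_weight w \<delta> N \<le> real d * q * 2" .
    have "exp (- (c * (\<delta> / 2))) / real d ^ m \<le> w m y"
    proof -
      \<comment> \<open>The upper pressure bound costs a factor \<open>d ^ m\<close>, harmless as
        \<open>m\<close> is fixed before \<open>c\<close> grows.\<close>
      have "real m * P c \<le> real m * (c * beta + ln (real d))" using P by (intro mult_left_mono) auto
      moreover have "c * (real m * beta - \<delta> / 2) \<le> c * S m y"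
        using m c0(1)[OF c] by (intro mult_left_mono) auto
      ultimately have "- (c * (\<delta> / 2)) - real m * ln (real d) \<le> c * S m y - real m * P c"
        by (simp add: algebra_simps)
      then have "exp (- (c * (\<delta> / 2)) - real m * ln (real d)) \<le> w m y" by (simp add: w_def)
      moreover have "exp (- (c * (\<delta> / 2)) - real m * ln (real d)) = exp (- (c * (\<delta> / 2))) / real d ^ m"
        using d by (simp add: exp_diff exp_of_nat_mult)
      ultimately show ?thesis by simp
    qed
    also have "w m y \<le> (\<Sum>n=1..N. \<Sum>x\<in>Per n. w n x)"
      using m N by (intro total_weight_ge) (auto simp: w_def)
    finally have Z: "exp (- (c * (\<delta> / 2))) / real d ^ m \<le> (\<Sum>n=1..N. \<Sum>x\<in>Per n. w n x)" .
    \<comment> \<open>Half of the exponent matches the lower bound on the total weight; the other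
      half remains as the small factor.\<close>
    have "q = exp (- (c * (\<delta> / 2))) * exp (- (c * (\<delta> / 2)))"
      by (simp add: q_def flip: exp_add)
    then have "real d * q * 2
        = (2 * real d ^ Suc m * exp (- (c * (\<delta> / 2)))) * (exp (- (c * (\<delta> / 2))) / real d ^ m)"
      using d by simp
    also have "\<dots> \<le> \<delta> * (exp (- (c * (\<delta> / 2))) / real d ^ m)"
      using c0(3)[OF c] by (intro mult_right_mono) auto
    also have "\<dots> \<le> \<delta> * (\<Sum>n=1..N. \<Sum>x\<in>Per n. w n x)"
      using Z \<delta> by (intro mult_left_mono) auto
    finally have "bad_weight w \<delta> N \<le> \<delta> * (\<Sum>n=1..N. \<Sum>x\<in>Per n. w n x)" using bad by simp
    moreover have "0 < w n x" for n x by (simp add: w_def)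
    ultimately have "(\<Sum>n=1..N. \<Sum>x\<in>Per n. w n x * (S n x / real n)) / (\<Sum>n=1..N. \<Sum>x\<in>Per n. w n x)
        \<ge> beta - (1 + beta) * \<delta>"
      using \<delta> m N by (intro weighted_mean_ge) auto
    then show ?thesis
      unfolding integral_pi_measure[OF th0 th1 continuous_f] w_def .
  qed
  then show ?thesis by blast
qed

text \<open>Without the pressure the weights can grow with the period, so all bad orbits are
  compared with period \<open>N\<close>: at most \<open>N * d ^ N\<close> terms of weight at most
  \<open>exp (c * (N * (beta - \<delta>)))\<close>, against a denominator of at least
  \<open>exp (c * (N * beta - 1 - C))\<close>. Large \<open>c\<close> beats the exponential count,
  large \<open>N\<close> the constant \<open>1 + C\<close>.\<close>

lemma integral_eta_ge:
  assumes \<delta>: "0 < \<delta>" "\<delta> \<le> beta"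
  shows "\<exists>c0 N0. \<forall>c\<ge>c0. \<forall>N\<ge>N0. integral\<^sup>L (eta_measure d \<theta> f c N) f \<ge> beta - (1 + beta) * \<delta>"
proof -
  have "\<forall>\<^sub>F c in at_top. 0 \<le> c \<and> 2 * real d * exp (- (c * (\<delta> / 2))) \<le> min \<delta> 1"
    using \<delta> by (intro eventually_conj eventually_exp_decay eventually_ge_at_top) auto
  then obtain c0 where c0: "\<And>c. c \<ge> c0 \<Longrightarrow> 0 \<le> c"
      "\<And>c. c \<ge> c0 \<Longrightarrow> 2 * real d * exp (- (c * (\<delta> / 2))) \<le> min \<delta> 1"
    by (auto simp: eventually_at_top_linorder)
  \<comment> \<open>From \<open>N0\<close> on, half of the deficit \<open>N * \<delta>\<close>
    absorbs \<open>1 + C\<close>; the other half is left as the decay \<open>q ^ N\<close>.\<close>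
  obtain N0 :: nat where "(1 + C) / (\<delta> / 2) \<le> real N0" using real_arch_simple by blast
  then have N0: "1 + C \<le> real N0 * (\<delta> / 2)" using \<delta> by (simp add: field_simps)
  have "integral\<^sup>L (eta_measure d \<theta> f c N) f \<ge> beta - (1 + beta) * \<delta>"
    if c: "c \<ge> c0" and N: "N \<ge> max 1 N0" for c N
  proof -
    define w where "w n x = exp (c * S n x)" for n :: nat and x
    define q where "q = exp (- (c * (\<delta> / 2)))"
    define Z where "Z = (\<Sum>n=1..N. \<Sum>x\<in>Per n. w n x)"
    have c': "0 \<le> c" by (rule c0(1)[OF c])
    have q: "0 < q" "2 * real d * q \<le> \<delta>" "2 * real d * q \<le> 1" using c0(2)[OF c] by (auto simp: q_def)
    have N1: "1 \<le> N" using N by simp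
    obtain y where y: "y \<in> Per N" "S N y \<ge> real N * beta - 1 - C" using S_Per_ge[OF N1] by blast
    have "exp (c * (real N * beta - 1 - C)) \<le> w N y"
      using y c' by (simp add: w_def mult_left_mono)
    also have "w N y \<le> Z"
      unfolding Z_def using y N1 by (intro total_weight_ge) (auto simp: w_def)
    finally have Z: "exp (c * (real N * beta - 1 - C)) \<le> Z" .
    have "bad_weight w \<delta> N \<le> (\<Sum>n=1..N. real d ^ n * exp (c * (real N * (beta - \<delta>))))"
    proof (rule bad_weight_le)
      fix n x assume n: "n \<le> N" and "S n x < real n * (beta - \<delta>)"
      \<comment> \<open>Here \<open>\<delta> \<le> beta\<close> enters: the bound is nondecreasing
        in the period.\<close>
      moreover have "real n * (beta - \<delta>) \<le> real N * (beta - \<delta>)"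
        using n \<delta> by (intro mult_right_mono) auto
      ultimately have "c * S n x \<le> c * (real N * (beta - \<delta>))"
        using c' by (intro mult_left_mono) auto
      then show "w n x \<le> exp (c * (real N * (beta - \<delta>)))" by (simp add: w_def)
    qed auto
    also have "\<dots> \<le> (\<Sum>n=1..N. real d ^ N * exp (c * (real N * (beta - \<delta>))))"
      using d by (intro sum_mono mult_right_mono power_increasing) auto
    also have "\<dots> = real N * (real d ^ N * exp (c * (real N * (beta - \<delta>))))" by simp
    \<comment> \<open>Replacing the factor \<open>N\<close> by \<open>2 ^ N\<close> lets the count
      and the decay merge into the \<open>N\<close>-th power of \<open>2 * d * q\<close>.\<close>
    also have "\<dots> \<le> 2 ^ N * (real d ^ N * exp (c * (real N * (beta - \<delta>))))"
      using less_exp[of N] by (intro mult_right_mono) (auto simp: less_imp_le)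
    also have "\<dots> \<le> 2 ^ N * (real d ^ N * (q ^ N * exp (c * (real N * beta - 1 - C))))"
    proof (intro mult_left_mono)
      have "1 + C \<le> real N * (\<delta> / 2)"
        using N \<delta> by (intro order_trans[OF N0] mult_right_mono) auto
      then have "c * (1 + C) \<le> c * (real N * (\<delta> / 2))" using c' by (intro mult_left_mono)
      then have "exp (c * (real N * (beta - \<delta>)))
          \<le> exp (real N * (- (c * (\<delta> / 2))) + c * (real N * beta - 1 - C))"
        by (simp add: algebra_simps)
      also have "\<dots> = q ^ N * exp (c * (real N * beta - 1 - C))"
        by (simp only: exp_add exp_of_nat_mult q_def)
      finally show "exp (c * (real N * (beta - \<delta>))) \<le> q ^ N * exp (c * (real N * beta - 1 - C))" .
    qed auto
    also have "\<dots> = (2 * real d * q) ^ N * exp (c * (real N * beta - 1 - C))"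
      by (simp add: power_mult_distrib)
    also have "\<dots> \<le> \<delta> * Z"
    proof (rule mult_mono[OF _ Z])
      have "(2 * real d * q) ^ N \<le> (2 * real d * q) ^ 1"
        using q N1 by (intro power_decreasing) auto
      then show "(2 * real d * q) ^ N \<le> \<delta>" using q by simp
    qed (use \<delta> in auto)
    finally have "bad_weight w \<delta> N \<le> \<delta> * Z" .
    moreover have "0 < w n x" for n x by (simp add: w_def)
    ultimately have "(\<Sum>n=1..N. \<Sum>x\<in>Per n. w n x * (S n x / real n)) / Z \<ge> beta - (1 + beta) * \<delta>"
      unfolding Z_def using \<delta> N by (intro weighted_mean_ge) auto
    then show ?thesis
      unfolding integral_eta_measure[OF th0 th1 continuous_f] w_def Z_def .
  qed
  then show ?thesis by blast
qed

text \<open>Isolates what the limit arguments use of either family, so that they are carried out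
  once. For \<open>N = 0\<close> the orbit measure is the zero measure, and the restriction
  \<open>\<delta> \<le> beta\<close> comes from the estimate for \<open>eta_measure\<close>.\<close>

definition maximizing_family :: "(real \<Rightarrow> nat \<Rightarrow> (nat \<Rightarrow> nat) measure) \<Rightarrow> bool" where
  "maximizing_family \<Xi> \<longleftrightarrow>
     (\<forall>c N. 1 \<le> N \<longrightarrow> \<Xi> c N \<in> invariant_probs (full_shift d \<theta>) shift_map) \<and>
     (\<forall>\<delta>>0. \<delta> \<le> beta \<longrightarrow>
        (\<exists>c0 N0. \<forall>c\<ge>c0. \<forall>N\<ge>N0. integral\<^sup>L (\<Xi> c N) f \<ge> beta - (1 + beta) * \<delta>))"

lemma maximizing_family_pi: "maximizing_family (pi_measure d \<theta> f)"
  unfolding maximizing_family_def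
  using pi_eta_invariant(1)[OF th0 th1 d] integral_pi_ge by blast

lemma maximizing_family_eta: "maximizing_family (eta_measure d \<theta> f)"
  unfolding maximizing_family_def
  using pi_eta_invariant(2)[OF th0 th1 d] integral_eta_ge by blast

lemma maximizing_family_eventually:
  assumes \<Xi>: "maximizing_family \<Xi>" and e: "0 < e"
  shows "\<forall>\<^sub>F (c, N) in at_top \<times>\<^sub>F at_top. 1 \<le> N \<and>
    \<Xi> c N \<in> invariant_probs (full_shift d \<theta>) shift_map \<and> beta - e \<le> integral\<^sup>L (\<Xi> c N) f"
proof -
  \<comment> \<open>Chosen so that both \<open>\<delta> \<le> beta\<close> and
    \<open>(1 + beta) * \<delta> \<le> e\<close> hold.\<close>
  define \<delta> where "\<delta> = min e beta / (1 + beta)"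
  have "\<delta> \<le> min e beta / 1"
    unfolding \<delta>_def using e beta_pos by (intro divide_left_mono) auto
  moreover have "(1 + beta) * \<delta> = min e beta" using beta_pos by (simp add: \<delta>_def)
  moreover have "0 < \<delta>" using e beta_pos by (simp add: \<delta>_def)
  ultimately have \<delta>: "0 < \<delta>" "\<delta> \<le> beta" "(1 + beta) * \<delta> \<le> e" by auto
  then obtain c0 N0 where
    "\<And>c N. c \<ge> c0 \<Longrightarrow> N \<ge> N0 \<Longrightarrow> integral\<^sup>L (\<Xi> c N) f \<ge> beta - (1 + beta) * \<delta>"
    using \<Xi> unfolding maximizing_family_def by blast
  then have *: "beta - e \<le> integral\<^sup>L (\<Xi> c N) f" if "c \<ge> c0" "N \<ge> N0" for c N
    using \<delta>(3) that by (meson diff_left_mono order_trans)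
  show ?thesis
    unfolding eventually_prod_filter
    by (intro exI[of _ "\<lambda>c. c \<ge> c0"] exI[of _ "\<lambda>N. N \<ge> max 1 N0"])
       (use \<Xi> * in \<open>auto simp: maximizing_family_def eventually_conj_iff\<close>)
qed

lemma maximizing_family_sequence:
  assumes \<Xi>: "maximizing_family \<Xi>" and c: "filterlim c at_top sequentially"
    and N: "filterlim N at_top sequentially"
  shows "\<forall>\<^sub>F j in sequentially. \<Xi> (c j) (N j) \<in> invariant_probs (full_shift d \<theta>) shift_map"
    and "(\<lambda>j. integral\<^sup>L (\<Xi> (c j) (N j)) f) \<longlonglongrightarrow> beta"
proof -
  have cN: "filterlim (\<lambda>j. (c j, N j)) (at_top \<times>\<^sub>F at_top) sequentially"
    using c N by (rule filterlim_Pair)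
  have ev: "\<forall>\<^sub>F j in sequentially. \<Xi> (c j) (N j) \<in> invariant_probs (full_shift d \<theta>) shift_map \<and>
      beta - e \<le> integral\<^sup>L (\<Xi> (c j) (N j)) f" if "0 < e" for e
    using filterlim_iff[THEN iffD1, OF cN, rule_format, OF maximizing_family_eventually[OF \<Xi> that]]
    by eventually_elim auto
  show "\<forall>\<^sub>F j in sequentially. \<Xi> (c j) (N j) \<in> invariant_probs (full_shift d \<theta>) shift_map"
    using ev[OF zero_less_one] by eventually_elim auto
  show "(\<lambda>j. integral\<^sup>L (\<Xi> (c j) (N j)) f) \<longlonglongrightarrow> beta"
  proof (rule order_tendstoI)
    fix a assume "a < beta"
    then show "\<forall>\<^sub>F j in sequentially. a < integral\<^sup>L (\<Xi> (c j) (N j)) f"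
      using ev[of "(beta - a) / 2"] by (auto elim!: eventually_mono simp: field_simps)
  next
    fix a assume "beta < a"
    then show "\<forall>\<^sub>F j in sequentially. integral\<^sup>L (\<Xi> (c j) (N j)) f < a"
      using ev[OF zero_less_one] integral_invariant_le by (auto elim!: eventually_mono intro: le_less_trans)
  qed
qed

text \<open>Invariant measures obey the bound by \<open>beta\<close>, and along the diagonal
  \<open>c = N = j\<close> the integrals for \<open>pi_measure\<close> tend to it, so periodic
  orbits and invariant measures have the same supremum.\<close>

lemma max_mean_eq_beta: "max_mean (full_shift d \<theta>) shift_map f = beta"
proof (rule antisym)
  let ?I = "invariant_probs (full_shift d \<theta>) shift_map"
  have "?I \<noteq> {}" using pi_eta_invariant(1)[OF th0 th1 d, of 1] by auto
  then show "max_mean (full_shift d \<theta>) shift_map f \<le> beta"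
    unfolding max_mean_def by (intro cSUP_least integral_invariant_le)
  have bdd: "bdd_above ((\<lambda>\<nu>. integral\<^sup>L \<nu> f) ` ?I)"
    by (rule bdd_aboveI2) (rule integral_invariant_le)
  have "\<forall>\<^sub>F j in sequentially. integral\<^sup>L (pi_measure d \<theta> f (real j) j) f
      \<le> max_mean (full_shift d \<theta>) shift_map f"
    using maximizing_family_sequence(1)[OF maximizing_family_pi filterlim_real_sequentially filterlim_ident]
    by eventually_elim (auto simp: max_mean_def intro!: cSUP_upper bdd)
  then show "beta \<le> max_mean (full_shift d \<theta>) shift_map f"
    using maximizing_family_sequence(2)[OF maximizing_family_pi filterlim_real_sequentially filterlim_ident]
    by (intro tendsto_upperbound) auto
qed

section \<open>Accumulation points and limits of the two families\<close>

lemma accumulation_maximizing: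
  assumes \<Xi>: "maximizing_family \<Xi>"
  shows "accumulation_probs (full_shift d \<theta>) \<Xi> \<subseteq> maximizing_probs (full_shift d \<theta>) shift_map f"
proof
  fix \<mu> assume "\<mu> \<in> accumulation_probs (full_shift d \<theta>) \<Xi>"
  then obtain c N where \<mu>: "\<mu> \<in> borel_probs (full_shift d \<theta>)"
    and cN: "filterlim c at_top sequentially" "filterlim N at_top sequentially"
    and lim: "weak_star_limit (full_shift d \<theta>) (\<lambda>j. \<Xi> (c j) (N j)) \<mu>"
    by (auto simp: accumulation_probs_def)
  note seq = maximizing_family_sequence[OF \<Xi> cN]
  have "\<mu> \<in> invariant_probs (full_shift d \<theta>) shift_map"
    by (rule weak_star_limit_invariant[OF th0 th1 d \<mu> seq(1) lim])
  moreover have "(\<lambda>j. integral\<^sup>L (\<Xi> (c j) (N j)) f) \<longlonglongrightarrow> integral\<^sup>L \<mu> f"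
    using lim continuous_f by (simp add: weak_star_limit_def)
  then have "integral\<^sup>L \<mu> f = beta" using seq(2) by (rule LIMSEQ_unique)
  ultimately show "\<mu> \<in> maximizing_probs (full_shift d \<theta>) shift_map f"
    by (simp add: maximizing_probs_def max_mean_eq_beta)
qed

lemma accumulation_subsequence:
  assumes \<Xi>: "maximizing_family \<Xi>" and c: "filterlim c at_top sequentially"
    and N: "filterlim N at_top sequentially"
  obtains r \<mu> where "strict_mono (r :: nat \<Rightarrow> nat)" "\<mu> \<in> accumulation_probs (full_shift d \<theta>) \<Xi>"
    "weak_star_limit (full_shift d \<theta>) (\<lambda>j. \<Xi> (c (r j)) (N (r j))) \<mu>"
proof -
  \<comment> \<open>The compactness lemma wants probability measures at every index, so the first
    \<open>J\<close> terms are dropped and the indices of the subsequence raised by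
    \<open>J\<close>.\<close>
  obtain J where J: "\<And>j. j \<ge> J \<Longrightarrow> \<Xi> (c j) (N j) \<in> borel_probs (full_shift d \<theta>)"
    using maximizing_family_sequence(1)[OF assms]
    by (auto simp: eventually_sequentially invariant_probs_def)
  obtain r \<mu> where r: "strict_mono r" and \<mu>: "\<mu> \<in> borel_probs (full_shift d \<theta>)"
    and lim: "weak_star_limit (full_shift d \<theta>) (\<lambda>j. \<Xi> (c (r j + J)) (N (r j + J))) \<mu>"
    using weak_star_convergent_subsequence[OF th0 th1 d, of "\<lambda>j. \<Xi> (c (j + J)) (N (j + J))"] J
    by auto
  define s where "s j = r j + J" for j
  have s: "strict_mono s" using r by (simp add: s_def strict_mono_def)
  then have sl: "filterlim s at_top sequentially" by (rule filterlim_subseq)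
  have lim: "weak_star_limit (full_shift d \<theta>) (\<lambda>j. \<Xi> (c (s j)) (N (s j))) \<mu>"
    using lim by (simp add: s_def)
  moreover have "\<mu> \<in> accumulation_probs (full_shift d \<theta>) \<Xi>"
    unfolding accumulation_probs_def
    using \<mu> lim filterlim_compose[OF c sl] filterlim_compose[OF N sl] by blast
  ultimately show ?thesis using that s by blast
qed

lemma limit_attained:
  assumes \<Xi>: "maximizing_family \<Xi>" and g: "continuous_fun (full_shift d \<theta>) g"
    and c: "filterlim c at_top sequentially" and N: "filterlim N at_top sequentially"
    and lim: "(\<lambda>j::nat. integral\<^sup>L (\<Xi> (c j) (N j)) g) \<longlonglongrightarrow> l"
  shows "\<exists>\<mu>\<in>accumulation_probs (full_shift d \<theta>) \<Xi>. l = integral\<^sup>L \<mu> g"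
proof -
  obtain r \<mu> where r: "strict_mono r" and \<mu>: "\<mu> \<in> accumulation_probs (full_shift d \<theta>) \<Xi>"
    and "weak_star_limit (full_shift d \<theta>) (\<lambda>j. \<Xi> (c (r j)) (N (r j))) \<mu>"
    using accumulation_subsequence[OF \<Xi> c N] by blast
  then have "(\<lambda>j. integral\<^sup>L (\<Xi> (c (r j)) (N (r j))) g) \<longlonglongrightarrow> integral\<^sup>L \<mu> g"
    using g by (simp add: weak_star_limit_def)
  moreover have "(\<lambda>j. integral\<^sup>L (\<Xi> (c (r j)) (N (r j))) g) \<longlonglongrightarrow> l"
    using LIMSEQ_subseq_LIMSEQ[OF lim r] by (simp add: o_def)
  ultimately show ?thesis using \<mu> LIMSEQ_unique by blast
qed

text \<open>If convergence failed, parameters tending to infinity could be chosen that keep the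
  integrals \<open>e\<close> away from the limit; a convergent subsequence has a maximizing limit,
  which must be \<open>\<mu>\<close>, a contradiction.\<close>

lemma unique_maximizing_limit:
  assumes \<Xi>: "maximizing_family \<Xi>" and g: "continuous_fun (full_shift d \<theta>) g"
    and \<mu>: "maximizing_probs (full_shift d \<theta>) shift_map f = {\<mu>}"
  shows "((\<lambda>(c, N). integral\<^sup>L (\<Xi> c N) g) \<longlongrightarrow> integral\<^sup>L \<mu> g) (at_top \<times>\<^sub>F at_top)"
proof (rule tendstoI, rule ccontr)
  fix e :: real assume e: "0 < e"
    and nev: "\<not> (\<forall>\<^sub>F p in at_top \<times>\<^sub>F at_top.
      dist (case p of (c, N) \<Rightarrow> integral\<^sup>L (\<Xi> c N) g) (integral\<^sup>L \<mu> g) < e)"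
  have "\<exists>c N. c \<ge> real j \<and> N \<ge> j \<and> dist (integral\<^sup>L (\<Xi> c N) g) (integral\<^sup>L \<mu> g) \<ge> e" for j
  proof (rule ccontr)
    assume "\<not> ?thesis"
    then have "dist (integral\<^sup>L (\<Xi> c N) g) (integral\<^sup>L \<mu> g) < e" if "c \<ge> real j" "N \<ge> j" for c N
      using that by (meson not_less)
    then have "\<forall>\<^sub>F p in at_top \<times>\<^sub>F at_top.
        dist (case p of (c, N) \<Rightarrow> integral\<^sup>L (\<Xi> c N) g) (integral\<^sup>L \<mu> g) < e"
      unfolding eventually_prod_filter
      by (intro exI[of _ "\<lambda>c. c \<ge> real j"] exI[of _ "\<lambda>N. N \<ge> j"]) auto
    with nev show False by simp
  qed
  then obtain c N where cN: "\<And>j. c j \<ge> real j" "\<And>j. N j \<ge> j"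
    and far: "\<And>j. dist (integral\<^sup>L (\<Xi> (c j) (N j)) g) (integral\<^sup>L \<mu> g) \<ge> e"
    by metis
  have c: "filterlim c at_top sequentially"
    by (rule filterlim_at_top_mono[OF filterlim_real_sequentially]) (simp add: cN)
  have N: "filterlim N at_top sequentially"
    by (rule filterlim_at_top_mono[OF filterlim_ident]) (simp add: cN)
  obtain r \<mu>' where "\<mu>' \<in> accumulation_probs (full_shift d \<theta>) \<Xi>"
    and lim: "weak_star_limit (full_shift d \<theta>) (\<lambda>j. \<Xi> (c (r j)) (N (r j))) \<mu>'"
    using accumulation_subsequence[OF \<Xi> c N] by blast
  then have "\<mu>' = \<mu>" using accumulation_maximizing[OF \<Xi>] \<mu> by auto
  then have "(\<lambda>j. integral\<^sup>L (\<Xi> (c (r j)) (N (r j))) g) \<longlonglongrightarrow> integral\<^sup>L \<mu> g"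
    using lim g by (simp add: weak_star_limit_def)
  then have "\<forall>\<^sub>F j in sequentially. dist (integral\<^sup>L (\<Xi> (c (r j)) (N (r j))) g) (integral\<^sup>L \<mu> g) < e"
    using e by (rule tendstoD)
  then obtain j where "dist (integral\<^sup>L (\<Xi> (c (r j)) (N (r j))) g) (integral\<^sup>L \<mu> g) < e"
    by (auto simp: eventually_sequentially)
  then show False using far[of "r j"] by simp
qed

end

theorem theorem23:
  fixes d :: nat and \<theta> :: real and f :: "(nat \<Rightarrow> nat) \<Rightarrow> real"
  defines "X \<equiv> full_shift d \<theta>"
  assumes "1 \<le> d" and "0 < \<theta>" and "\<theta> < 1"
    and "Lipschitz_continuous_map X euclidean_metric f"
    and "\<forall>x\<in>mspace X. 0 < f x"
  shows
    "(accumulation_probs X (pi_measure d \<theta> f) \<subseteq> maximizing_probs X shift_map f \<and>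
      accumulation_probs X (eta_measure d \<theta> f) \<subseteq> maximizing_probs X shift_map f) \<and>
     (\<forall>\<Xi> \<in> {pi_measure d \<theta> f, eta_measure d \<theta> f}.
        \<forall>g c N L. continuous_fun X g \<longrightarrow>
          filterlim c at_top sequentially \<longrightarrow> filterlim N at_top sequentially \<longrightarrow>
          (\<lambda>j::nat. integral\<^sup>L (\<Xi> (c j) (N j)) g) \<longlonglongrightarrow> L \<longrightarrow>
          (\<exists>\<mu> \<in> accumulation_probs X \<Xi>. L = integral\<^sup>L \<mu> g)) \<and>
     (\<forall>\<mu>. maximizing_probs X shift_map f = {\<mu>} \<longrightarrow>
        (\<forall>g. continuous_fun X g \<longrightarrow>
          ((\<lambda>(c, N). integral\<^sup>L (pi_measure d \<theta> f c N) g) \<longlongrightarrow> integral\<^sup>L \<mu> g)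
            (at_top \<times>\<^sub>F at_top) \<and>
          ((\<lambda>(c, N). integral\<^sup>L (eta_measure d \<theta> f c N) g) \<longlongrightarrow> integral\<^sup>L \<mu> g)
            (at_top \<times>\<^sub>F at_top)))"
proof -
  note th = assms(3,4)
  obtain B where B: "\<And>x y. x \<in> shift_space d \<Longrightarrow> y \<in> shift_space d \<Longrightarrow>
      \<bar>f x - f y\<bar> \<le> B * shift_dist \<theta> x y"
    using assms(5)
    by (auto simp: X_def Lipschitz_continuous_map_def mspace_full_shift[OF th] mdist_full_shift[OF th]
        dist_real_def)
  \<comment> \<open>The sign of the Lipschitz constant \<open>B\<close> is unknown, while the locale
    asks for \<open>0 \<le> L\<close>; passing to the absolute value keeps the bound.\<close>
  interpret lipschitz_potential d \<theta> f "\<bar>B\<bar>"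
  proof
    fix x y assume xy: "x \<in> shift_space d" "y \<in> shift_space d"
    have "0 \<le> shift_dist \<theta> x y" using th by (simp add: shift_dist_def)
    then have "B * shift_dist \<theta> x y \<le> \<bar>B\<bar> * shift_dist \<theta> x y" by (intro mult_right_mono) auto
    then show "\<bar>f x - f y\<bar> \<le> \<bar>B\<bar> * shift_dist \<theta> x y" using B[OF xy] by linarith
  qed (use assms in \<open>auto simp: X_def mspace_full_shift[OF th]\<close>)
  note fam = maximizing_family_pi maximizing_family_eta
  show ?thesis
    unfolding X_def
    using fam[THEN accumulation_maximizing] limit_attained[OF fam(1)] limit_attained[OF fam(2)]
      unique_maximizing_limit[OF fam(1)] unique_maximizing_limit[OF fam(2)]
    by blast
qed

end
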